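(* Let $D$ be an integral domain and let $\Theta$ be a Jaffard family of $D$. Then there is an exact sequence $$0\longrightarrow\mathrm{Pic}(D)\longrightarrow\mathrm{Pic}(\mathrm{Int}(D))\longrightarrow\bigoplus_{T\in\Theta}\mathrm{Pic}_{\mathrm{Int}}(T)\longrightarrow 0.$$ In particular, $\mathrm{Pic}_{\mathrm{Int}}(D)\simeq\bigoplus_{T\in\Theta}\mathrm{Pic}_{\mathrm{Int}}(T)$.
   Context: $D$ is an integral domain with quotient field $K$; for a domain $A$ with quotient field $K$, $\mathrm{Int}(A)=\{f\in K[X]\mid f(A)\subseteq A\}$, and $\mathrm{Pic}(A)$ is the group of invertible fractional ideals of $A$ modulo principal fractional ideals. Let $\iota_A:\mathrm{Pic}(A)\to\mathrm{Pic}(\mathrm{Int}(A))$, $[I]\mapsto[I\,\mathrm{Int}(A)]$ be the canonical (injective) extension map, and define the int-polynomial Picard group $\mathrm{Pic}_{\mathrm{Int}}(A):=\mathrm{Pic}(\mathrm{Int}(A))/\iota_A(\mathrm{Pic}(A))$. An overring is a ring between $D$ and $K$; it is flat if it is flat as a $D$-module. A family $\Theta$ of overrings of $D$ is a pre-Jaffard family if: either $\Theta=\{K\}$ or $K\notin\Theta$; every $T\in\Theta$ is flat over $D$; $\Theta$ is complete (every ideal $I$ of $D$ satisfies $I=\bigcap_{T\in\Theta}IT$); $\Theta$ is independent ($TT'=K$ for $T\neq T'$ in $\Theta$); and $\Theta$ is compact in the Zariski topology of the set of overrings of $D$ (subbasic open sets $\{T\mid x_1,\dots,x_n\in T\}$,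 $x_i\in K$). A Jaffard family is a pre-Jaffard family that is locally finite: every nonzero $x\in D$ is a nonunit in only finitely many $T\in\Theta$. *)

theory Defs
  imports "HOL-Analysis.Analysis" "HOL-Algebra.Algebra"
    "HOL-Computational_Algebra.Polynomial" "HOL-Computational_Algebra.Fraction_Field"
begin

text \<open>Ambient convention: all domains live inside a fixed field (a type of class field),
which plays the role of the quotient field.  Rings are subsets of that field.\<close>

definition subring_of :: "'f::field set \<Rightarrow> bool" where
  "subring_of R \<longleftrightarrow> 0 \<in> R \<and> 1 \<in> R \<and> (\<forall>x\<in>R. \<forall>y\<in>R. x + y \<in> R \<and> x * y \<in> R \<and> - x \<in> R)"

definition domain_with_qf :: "'f::field set \<Rightarrow> bool" where
  "domain_with_qf R \<longleftrightarrow> subring_of R \<and> (\<forall>z. \<exists>a\<in>R. \<exists>b\<in>R. b \<noteq> 0 \<and> z = a / b)"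

definition overring :: "'f::field set \<Rightarrow> 'f set \<Rightarrow> bool" where
  "overring D T \<longleftrightarrow> subring_of T \<and> D \<subseteq> T"

definition submodule_of :: "'f::field set \<Rightarrow> 'f set \<Rightarrow> bool" where
  "submodule_of R M \<longleftrightarrow> 0 \<in> M \<and> (\<forall>x\<in>M. \<forall>y\<in>M. x + y \<in> M) \<and> (\<forall>r\<in>R. \<forall>x\<in>M. r * x \<in> M)"

definition ideal_of :: "'f::field set \<Rightarrow> 'f set \<Rightarrow> bool" where
  "ideal_of R I \<longleftrightarrow> submodule_of R I \<and> I \<subseteq> R"

text \<open>Additive subgroup generated by all products x*y (x in A, y in B): the product IJ of
submodules, the extension IT of an ideal, the compositum TT' of two rings.\<close>
definition prod_span :: "'f::field set \<Rightarrow> 'f set \<Rightarrow> 'f set" where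
  "prod_span A B = \<Inter> {M. 0 \<in> M \<and> (\<forall>x\<in>M. \<forall>y\<in>M. x + y \<in> M \<and> - x \<in> M)
                          \<and> {x * y | x y. x \<in> A \<and> y \<in> B} \<subseteq> M}"

text \<open>Flatness of a D-submodule M of the field, via the equational criterion of flatness.\<close>
definition flat_over :: "'f::field set \<Rightarrow> 'f set \<Rightarrow> bool" where
  "flat_over D M \<longleftrightarrow> submodule_of D M \<and>
     (\<forall>n (a :: nat \<Rightarrow> 'f) (x :: nat \<Rightarrow> 'f).
        (\<forall>i<n. a i \<in> D \<and> x i \<in> M) \<and> (\<Sum>i<n. a i * x i) = 0 \<longrightarrow>
        (\<exists>m (y :: nat \<Rightarrow> 'f) (b :: nat \<Rightarrow> nat \<Rightarrow> 'f).
            (\<forall>j<m. y j \<in> M) \<and> (\<forall>i<n. \<forall>j<m. b i j \<in> D) \<and>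
            (\<forall>i<n. x i = (\<Sum>j<m. b i j * y j)) \<and>
            (\<forall>j<m. (\<Sum>i<n. a i * b i j) = 0)))"

definition zariski_overrings :: "'f::field set \<Rightarrow> 'f set topology" where
  "zariski_overrings D = topology_generated_by
      {{T. overring D T \<and> F \<subseteq> T} | F. finite F}"

definition is_unit_in :: "'f::field set \<Rightarrow> 'f \<Rightarrow> bool" where
  "is_unit_in T x \<longleftrightarrow> x \<in> T \<and> (\<exists>y\<in>T. x * y = 1)"

definition pre_jaffard :: "'f::field set \<Rightarrow> 'f set set \<Rightarrow> bool" where
  "pre_jaffard D \<Theta> \<longleftrightarrow>
     (\<forall>T\<in>\<Theta>. overring D T) \<and>
     (\<Theta> = {UNIV} \<or> UNIV \<notin> \<Theta>) \<and>
     (\<forall>T\<in>\<Theta>. flat_over D T) \<and>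
     (\<forall>I. ideal_of D I \<longrightarrow> I = (\<Inter>T\<in>\<Theta>. prod_span I T)) \<and>
     (\<forall>T\<in>\<Theta>. \<forall>T'\<in>\<Theta>. T \<noteq> T' \<longrightarrow> prod_span T T' = UNIV) \<and>
     compactin (zariski_overrings D) \<Theta>"

definition jaffard :: "'f::field set \<Rightarrow> 'f set set \<Rightarrow> bool" where
  "jaffard D \<Theta> \<longleftrightarrow> pre_jaffard D \<Theta> \<and>
     (\<forall>x\<in>D. x \<noteq> 0 \<longrightarrow> finite {T\<in>\<Theta>. \<not> is_unit_in T x})"

definition frac_ideal :: "'f::field set \<Rightarrow> 'f set \<Rightarrow> bool" where
  "frac_ideal R I \<longleftrightarrow> submodule_of R I \<and> I \<noteq> {0} \<and>
     (\<exists>d\<in>R. d \<noteq> 0 \<and> (\<forall>x\<in>I. d * x \<in> R))"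

definition invertible_frac_ideal :: "'f::field set \<Rightarrow> 'f set \<Rightarrow> bool" where
  "invertible_frac_ideal R I \<longleftrightarrow> frac_ideal R I \<and>
     (\<exists>J. frac_ideal R J \<and> prod_span I J = R)"

definition principal_frac_ideal :: "'f::field set \<Rightarrow> 'f set \<Rightarrow> bool" where
  "principal_frac_ideal R I \<longleftrightarrow> (\<exists>x. x \<noteq> 0 \<and> I = {r * x | r. r \<in> R})"

definition InvIdeals :: "'f::field set \<Rightarrow> 'f set monoid" where
  "InvIdeals R = \<lparr>carrier = {I. invertible_frac_ideal R I}, mult = prod_span, one = R\<rparr>"

definition Pic :: "'f::field set \<Rightarrow> 'f set set monoid" where
  "Pic R = InvIdeals R Mod {I. invertible_frac_ideal R I \<and> principal_frac_ideal R I}"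

definition IntPoly :: "'k::field set \<Rightarrow> 'k poly set" where
  "IntPoly A = {f. \<forall>a\<in>A. poly f a \<in> A}"

definition IntR :: "'k::field set \<Rightarrow> 'k poly fract set" where
  "IntR A = (\<lambda>f. Fract f 1) ` IntPoly A"

definition const_fract :: "'k::field \<Rightarrow> 'k poly fract" where
  "const_fract c = Fract [:c:] 1"

definition iota :: "'k::field set \<Rightarrow> 'k set set \<Rightarrow> 'k poly fract set set" where
  "iota A C = {J. invertible_frac_ideal (IntR A) J \<and> principal_frac_ideal (IntR A) J}
       #>\<^bsub>InvIdeals (IntR A)\<^esub> (prod_span (const_fract ` (SOME I. I \<in> C)) (IntR A))"

definition PicInt :: "'k::field set \<Rightarrow> 'k poly fract set set set monoid" where
  "PicInt A = Pic (IntR A) Mod (iota A ` carrier (Pic A))"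

end

theory Submission
  imports Defs
begin

text \<open>
  Flatness of an overring \<open>T\<close> enters only through its consequence that the denominators in \<open>D\<close> of any
  element of \<open>T\<close> generate the unit ideal of \<open>T\<close>.  Together with completeness this makes a \<open>D\<close>-module the
  intersection of its extensions to the members of \<open>\<Theta>\<close>; together with independence and local finiteness it
  yields, for \<open>T \<in> \<Theta>\<close> and \<open>d \<noteq> 0\<close>, some \<open>v \<in> D\<close> with \<open>v \<equiv> 1\<close> modulo \<open>dT\<close> and \<open>v \<in> dT'\<close> for all other
  \<open>T' \<in> \<Theta>\<close>.  This approximation gives \<open>Int(T) = Int(D) T\<close> and allows local modules with a common
  denominator to be glued.

  Since \<open>K[X]\<close> is a principal ideal domain, every Picard class of \<open>Int(D)\<close> is represented by an ideal that
  contains, as does its inverse, a nonzero constant.  Such an ideal is locally trivial wherever that constant is a unit, so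
  localization maps into the direct sum.  Gluing inverse pairs of ideals of \<open>Int(T)\<close> gives surjectivity, and gluing
  ideals of constants identifies the kernel.
\<close>

text \<open>In a localization at a multiplicative set one denominator serves each element. A flat
  overring only offers an ideal of denominators, so the arguments run through conductors such as
  \<open>{d \<in> D. h d * x \<in> M}\<close> rather than through chosen denominators. The main
  obstacle is that an infinite intersection of local modules need not extend back to the modules it
  was built from. The approximating element \<open>v\<close> repairs this: in
  \<open>x = v x + (1 - v) x\<close> the first summand lies in every local module, and the second is
  a \<open>T\<close>-multiple of an element that does. The approximation takes place in
  \<open>D\<close>, so its modulus has to come from constants that bound all the local modules at
  once. For inverses to be glued as well, the same constant has to lie in them too. This is why
  representatives are normalized so that they and their inverses contain a common constant. Gluing
  is needed both in \<open>K\<close> and in \<open>K(X)\<close>; the two cases are instances of one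
  statement about a homomorphism \<open>h\<close> from \<open>K\<close> into a field.\<close>

notation prod_span (infixl "\<star>" 70)

section \<open>Products of subsets of a field, and modules as solutions of
  \<open>M \<star> R = M\<close>\<close>

definition add_subgroup :: "'f::field set \<Rightarrow> bool" where
  "add_subgroup M \<longleftrightarrow> 0 \<in> M \<and> (\<forall>x\<in>M. \<forall>y\<in>M. x + y \<in> M \<and> - x \<in> M)"

lemma add_subgroupI:
  "0 \<in> M \<Longrightarrow> (\<And>x y. x \<in> M \<Longrightarrow> y \<in> M \<Longrightarrow> x + y \<in> M) \<Longrightarrow> (\<And>x. x \<in> M \<Longrightarrow> - x \<in> M)
    \<Longrightarrow> add_subgroup M"
  by (auto simp: add_subgroup_def)

lemma add_subgroupD:
  assumes "add_subgroup M"
  shows "0 \<in> M" "x \<in> M \<Longrightarrow> y \<in> M \<Longrightarrow> x + y \<in> M" "x \<in> M \<Longrightarrow> - x \<in> M"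
    "x \<in> M \<Longrightarrow> y \<in> M \<Longrightarrow> x - y \<in> M"
proof -
  show *: "0 \<in> M" "x \<in> M \<Longrightarrow> y \<in> M \<Longrightarrow> x + y \<in> M" "x \<in> M \<Longrightarrow> - x \<in> M" for x y
    using assms by (auto simp: add_subgroup_def)
  show "x \<in> M \<Longrightarrow> y \<in> M \<Longrightarrow> x - y \<in> M"
    using *(2)[of x "- y"] *(3)[of y] by simp
qed

lemma add_subgroup_sum:
  assumes "add_subgroup M" "\<And>i. i \<in> S \<Longrightarrow> f i \<in> M"
  shows "sum f S \<in> M"
  using assms(2) by (induction S rule: infinite_finite_induct) (auto intro: add_subgroupD[OF assms(1)])

lemma add_subgroup_inter: "add_subgroup A \<Longrightarrow> add_subgroup B \<Longrightarrow> add_subgroup (A \<inter> B)"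
  by (auto simp: add_subgroup_def)

lemma add_subgroup_Inter: "(\<And>i. i \<in> S \<Longrightarrow> add_subgroup (A i)) \<Longrightarrow> add_subgroup (\<Inter>i\<in>S. A i)"
  by (auto simp: add_subgroup_def)

lemma prod_span_mem: "a \<in> A \<Longrightarrow> b \<in> B \<Longrightarrow> a * b \<in> A \<star> B"
  unfolding prod_span_def by blast

lemma add_subgroup_prod_span: "add_subgroup (A \<star> B)"
  by (auto simp: prod_span_def add_subgroup_def)

lemmas prod_span_closed = add_subgroupD[OF add_subgroup_prod_span]

text \<open>The universal property of \<open>\<star>\<close> takes the place of writing elements of
  a product as finite sums: a claim about all elements of \<open>A \<star> B\<close> is proved by
  showing that the elements satisfying it form an additive subgroup containing the products.\<close>

lemma prod_span_least:
  assumes "add_subgroup M" "\<And>a b. a \<in> A \<Longrightarrow> b \<in> B \<Longrightarrow> a * b \<in> M"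
  shows "A \<star> B \<subseteq> M"
  using assms unfolding prod_span_def add_subgroup_def by (intro Inter_lower) blast

lemma prod_span_mono: "A \<subseteq> A' \<Longrightarrow> B \<subseteq> B' \<Longrightarrow> A \<star> B \<subseteq> A' \<star> B'"
  by (intro prod_span_least add_subgroup_prod_span) (auto intro: prod_span_mem)

lemma prod_span_commute: "A \<star> B = B \<star> A"
proof -
  have "A \<star> B \<subseteq> B \<star> A" for A B :: "'f::field set"
    by (intro prod_span_least add_subgroup_prod_span) (subst mult.commute, rule prod_span_mem)
  then show ?thesis by blast
qed

text \<open>Fixing one factor \<open>c\<close> reduces an inclusion of a triple product to one of a
  double product, where \<open>prod_span_least\<close> applies. Associativity of
  \<open>\<star>\<close> is obtained in this way.\<close>

lemma add_subgroup_scale_vimage: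
  assumes "add_subgroup M"
  shows "add_subgroup {x. x * c \<in> M}"
proof (rule add_subgroupI)
  fix x y
  assume "x \<in> {x. x * c \<in> M}" "y \<in> {x. x * c \<in> M}"
  then show "x + y \<in> {x. x * c \<in> M}"
    using add_subgroupD(2)[OF assms] by (simp add: distrib_right)
next
  fix x
  assume "x \<in> {x. x * c \<in> M}"
  then show "- x \<in> {x. x * c \<in> M}" using add_subgroupD(3)[OF assms] by simp
qed (use add_subgroupD[OF assms] in auto)

lemma prod_span_assoc: "(A \<star> B) \<star> C = A \<star> (B \<star> C)"
proof -
  have le: "(A \<star> B) \<star> C \<subseteq> A \<star> (B \<star> C)" for A B C :: "'f::field set"
  proof (intro prod_span_least add_subgroup_prod_span)
    fix x c assume "x \<in> A \<star> B" and c: "c \<in> C"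
    have "A \<star> B \<subseteq> {x. x * c \<in> A \<star> (B \<star> C)}"
      by (intro prod_span_least add_subgroup_scale_vimage add_subgroup_prod_span)
        (use c in \<open>auto simp: mult.assoc intro: prod_span_mem\<close>)
    with \<open>x \<in> A \<star> B\<close> show "x * c \<in> A \<star> (B \<star> C)" by blast
  qed
  moreover have "A \<star> (B \<star> C) \<subseteq> (A \<star> B) \<star> C"
    using le[of C B A] by (simp add: prod_span_commute)
  ultimately show ?thesis by blast
qed

lemma prod_span_left_commute: "A \<star> (B \<star> C) = B \<star> (A \<star> C)"
  by (simp only: prod_span_assoc[symmetric] prod_span_commute[of A B])

lemmas prod_span_ac = prod_span_assoc prod_span_commute prod_span_left_commute

lemma subset_prod_span_one: "1 \<in> B \<Longrightarrow> A \<subseteq> A \<star> B"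
  using prod_span_mem[of _ A 1 B] by auto

lemma subring_ofD:
  assumes "subring_of R"
  shows "0 \<in> R" "1 \<in> R" "x \<in> R \<Longrightarrow> y \<in> R \<Longrightarrow> x + y \<in> R" "x \<in> R \<Longrightarrow> y \<in> R \<Longrightarrow> x * y \<in> R"
    "x \<in> R \<Longrightarrow> - x \<in> R" "x \<in> R \<Longrightarrow> y \<in> R \<Longrightarrow> x - y \<in> R" "add_subgroup R"
    "x \<in> R \<Longrightarrow> x ^ n \<in> R" "of_nat n \<in> R"
proof -
  show *: "0 \<in> R" "1 \<in> R" "x \<in> R \<Longrightarrow> y \<in> R \<Longrightarrow> x + y \<in> R" "x \<in> R \<Longrightarrow> y \<in> R \<Longrightarrow> x * y \<in> R"
    "x \<in> R \<Longrightarrow> - x \<in> R" for x y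
    using assms by (auto simp: subring_of_def)
  show "add_subgroup R" using * by (auto intro: add_subgroupI)
  then show "x \<in> R \<Longrightarrow> y \<in> R \<Longrightarrow> x - y \<in> R" by (rule add_subgroupD)
  show "x \<in> R \<Longrightarrow> x ^ n \<in> R" by (induction n) (auto intro: *)
  show "of_nat n \<in> R" by (induction n) (auto intro: *)
qed

lemma domain_with_qfD:
  assumes "domain_with_qf R"
  shows "subring_of R" "\<And>z. \<exists>a\<in>R. \<exists>b\<in>R. b \<noteq> 0 \<and> z = a / b"
  using assms by (auto simp: domain_with_qf_def)

text \<open>Modules become solutions of an equation, so that most identities between ideals follow
  from \<open>prod_span_ac\<close> alone. Closure under negation comes from
  \<open>- 1 \<in> R\<close>.\<close>

lemma submodule_of_iff:
  assumes "subring_of R"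
  shows "submodule_of R M \<longleftrightarrow> M \<star> R = M"
proof
  assume M: "submodule_of R M"
  have "- x \<in> M" if "x \<in> M" for x
  proof -
    have "- 1 \<in> R" using assms by (auto simp: subring_of_def)
    then have "- 1 * x \<in> M" using M that by (auto simp only: submodule_of_def)
    then show ?thesis by simp
  qed
  then have "add_subgroup M" using M by (auto simp: add_subgroup_def submodule_of_def)
  then have "M \<star> R \<subseteq> M"
  proof (rule prod_span_least)
    show "a * b \<in> M" if "a \<in> M" "b \<in> R" for a b
      by (subst mult.commute) (use M that in \<open>simp add: submodule_of_def\<close>)
  qed
  then show "M \<star> R = M"
    using subset_prod_span_one subring_ofD(2)[OF assms] by blast
next
  assume *: "M \<star> R = M"
  then show "submodule_of R M"
    using prod_span_closed(1,2)[where A = M and B = R] prod_span_mem[of _ R _ M]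
    by (simp add: submodule_of_def prod_span_commute[of R M])
qed

lemma prod_span_subring: "subring_of R \<Longrightarrow> R \<star> R = R"
  by (subst submodule_of_iff[symmetric]) (auto simp: submodule_of_def subring_of_def)

lemma prod_span_overring: "subring_of S \<Longrightarrow> subring_of R \<Longrightarrow> R \<subseteq> S \<Longrightarrow> S \<star> R = S"
  by (subst submodule_of_iff[symmetric]) (auto simp: submodule_of_def subring_of_def)

lemma prod_span_idI:
  assumes "subring_of R" "add_subgroup M" "\<And>x r. x \<in> M \<Longrightarrow> r \<in> R \<Longrightarrow> x * r \<in> M"
  shows "M \<star> R = M"
  using assms subset_prod_span_one[of R M] subring_ofD(2)[OF assms(1)]
    prod_span_least[of M M R] by blast

lemma add_subgroup_of_module: "M \<star> R = M \<Longrightarrow> add_subgroup M"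
  using add_subgroup_prod_span[of M R] by simp

lemma module_scale: "M \<star> R = M \<Longrightarrow> x \<in> M \<Longrightarrow> r \<in> R \<Longrightarrow> x * r \<in> M"
  using prod_span_mem[of x M r R] by simp

text \<open>Scaling by \<open>x\<close> is written as a product with \<open>{x}\<close> throughout,
  so that scalars move through ideal products by the same rearrangement rules as ideals do.\<close>

lemma singleton_prod_span:
  assumes "add_subgroup M"
  shows "{x} \<star> M = (\<lambda>m. x * m) ` M"
proof
  have "add_subgroup ((\<lambda>m. x * m) ` M)"
  proof (rule add_subgroupI)
    show "0 \<in> (\<lambda>m. x * m) ` M"
      using rev_image_eqI[of 0 M 0 "\<lambda>m. x * m"] add_subgroupD(1)[OF assms] by simp
  next
    fix a b assume "a \<in> (\<lambda>m. x * m) ` M" "b \<in> (\<lambda>m. x * m) ` M"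
    then obtain a' b' where "a' \<in> M" "b' \<in> M" "a = x * a'" "b = x * b'" by blast
    then show "a + b \<in> (\<lambda>m. x * m) ` M"
      by (intro image_eqI[where x = "a' + b'"]) (auto simp: distrib_left intro: add_subgroupD[OF assms])
  next
    fix a assume "a \<in> (\<lambda>m. x * m) ` M"
    then obtain a' where "a' \<in> M" "a = x * a'" by blast
    then show "- a \<in> (\<lambda>m. x * m) ` M"
      by (intro image_eqI[where x = "- a'"]) (auto intro: add_subgroupD[OF assms])
  qed
  then show "{x} \<star> M \<subseteq> (\<lambda>m. x * m) ` M"
    by (rule prod_span_least) auto
qed (auto intro: prod_span_mem)

lemma prod_span_singletons: "{x} \<star> ({y} \<star> M) = {x * y} \<star> M"
proof
  have "{y} \<star> M \<subseteq> {z. z * x \<in> {x * y} \<star> M}"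
  proof (intro prod_span_least add_subgroup_scale_vimage add_subgroup_prod_span)
    fix a b assume "a \<in> {y}" "b \<in> M"
    then show "a * b \<in> {z. z * x \<in> {x * y} \<star> M}"
      using prod_span_mem[of "x * y" "{x * y}" b M] by (simp add: mult_ac)
  qed
  then show "{x} \<star> ({y} \<star> M) \<subseteq> {x * y} \<star> M"
    by (intro prod_span_least add_subgroup_prod_span) (auto simp: mult.commute)
  show "{x * y} \<star> M \<subseteq> {x} \<star> ({y} \<star> M)"
    by (intro prod_span_least add_subgroup_prod_span) (auto simp: mult.assoc intro: prod_span_mem)
qed

lemma prod_span_one: "add_subgroup M \<Longrightarrow> {1} \<star> M = M"
  by (simp add: singleton_prod_span)

lemma prod_span_singleton_cancel:
  assumes "x \<noteq> 0" "add_subgroup M"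
  shows "{x} \<star> ({inverse x} \<star> M) = M" "{inverse x} \<star> ({x} \<star> M) = M"
  using assms by (simp_all add: prod_span_singletons prod_span_one)

text \<open>Two instances matter: the identity, for an inclusion of rings in one field, and
  \<open>const_fract\<close>, the embedding of \<open>K\<close> into \<open>K(X)\<close>. Extension
  of ideals is then a single construction for both.\<close>

locale unital_hom =
  fixes h :: "'k::field \<Rightarrow> 'l::field"
  assumes hom_one: "h 1 = 1" and hom_add: "h (x + y) = h x + h y" and hom_mult: "h (x * y) = h x * h y"
begin

lemma hom_zero: "h 0 = 0"
proof -
  have "h 0 + h 0 = h 0 + 0" using hom_add[of 0 0] by simp
  then show ?thesis by (rule add_left_imp_eq)
qed

lemma hom_minus: "h (- x) = - h x"
  using hom_add[of x "- x"] by (simp add: hom_zero add_eq_0_iff)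

lemma hom_diff: "h (x - y) = h x - h y"
  using hom_add[of x "- y"] by (simp add: hom_minus)

lemma hom_eq_0_iff: "h x = 0 \<longleftrightarrow> x = 0"
  using hom_mult[of x "inverse x"] hom_one hom_zero by (cases "x = 0") auto

lemma add_subgroup_image:
  assumes "add_subgroup M" shows "add_subgroup (h ` M)"
  using add_subgroupD[OF assms] rev_image_eqI[of 0 M 0 h]
  by (intro add_subgroupI) (auto simp: hom_zero simp flip: hom_add hom_minus)

lemma add_subgroup_vimage: "add_subgroup M \<Longrightarrow> add_subgroup (h -` M)"
  by (auto simp: add_subgroup_def hom_zero hom_add hom_minus)

lemma subring_of_image:
  assumes "subring_of R" shows "subring_of (h ` R)"
  unfolding subring_of_def
  using subring_ofD[OF assms] rev_image_eqI[of 0 R 0 h] rev_image_eqI[of 1 R 1 h]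
  by (auto simp: hom_zero hom_one simp flip: hom_add hom_mult hom_minus)

lemma image_prod_span: "h ` (A \<star> B) = h ` A \<star> h ` B"
proof
  have "A \<star> B \<subseteq> h -` (h ` A \<star> h ` B)"
    by (intro prod_span_least add_subgroup_vimage add_subgroup_prod_span)
       (auto simp: hom_mult intro: prod_span_mem)
  then show "h ` (A \<star> B) \<subseteq> h ` A \<star> h ` B" by blast
  show "h ` A \<star> h ` B \<subseteq> h ` (A \<star> B)"
    by (intro prod_span_least add_subgroup_image add_subgroup_prod_span)
       (auto simp flip: hom_mult intro: prod_span_mem)
qed

end

lemma unital_hom_id: "unital_hom (\<lambda>x. x)"
  by unfold_locales auto

section \<open>Invertible ideals and the Picard group\<close>

lemma singleton_prod_span_eq:
  assumes "subring_of R"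
  shows "{x} \<star> R = {r * x | r. r \<in> R}"
  by (auto simp: singleton_prod_span[OF subring_ofD(7)[OF assms]] mult.commute image_iff)

text \<open>From \<open>I \<star> J = R\<close> there is a nonzero \<open>j = a / b\<close> in
  \<open>J\<close>, and its numerator \<open>a\<close> is a common denominator of \<open>I\<close>,
  since \<open>a * x = b * (x * j)\<close> for \<open>x \<in> I\<close>. Invertibility thus becomes
  purely equational.\<close>

lemma invertible_frac_ideal_iff:
  assumes "domain_with_qf R"
  shows "invertible_frac_ideal R I \<longleftrightarrow> I \<star> R = I \<and> (\<exists>J. J \<star> R = J \<and> I \<star> J = R)"
proof -
  note R = domain_with_qfD(1)[OF assms]
  have frac: "frac_ideal R I" if "I \<star> R = I" "J \<star> R = J" "I \<star> J = R" for I J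
  proof -
    have "\<exists>x\<in>J. x \<noteq> 0"
    proof (rule ccontr)
      assume "\<not> (\<exists>x\<in>J. x \<noteq> 0)"
      then have "I \<star> J \<subseteq> {0}" by (intro prod_span_least) (auto simp: add_subgroup_def)
      then show False using that subring_ofD(2)[OF R] by auto
    qed
    then obtain j where j: "j \<in> J" "j \<noteq> 0" by blast
    have "I \<noteq> {0}"
    proof
      assume "I = {0}"
      then have "I \<star> J \<subseteq> {0}" by (intro prod_span_least) (auto simp: add_subgroup_def)
      then show False using that subring_ofD(2)[OF R] by auto
    qed
    moreover obtain a b where ab: "a \<in> R" "b \<in> R" "b \<noteq> 0" "j = a / b"
      using domain_with_qfD(2)[OF assms] by blast
    have "a * x \<in> R" if "x \<in> I" for x
    proof -
      have "x * j \<in> R" using that j \<open>I \<star> J = R\<close> prod_span_mem by blast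
      then have "b * (x * j) \<in> R" using ab(2) R by (auto intro: subring_ofD)
      moreover have "b * (x * j) = a * x" using ab(3,4) by simp
      ultimately show ?thesis by simp
    qed
    moreover have "a \<noteq> 0" using ab j by auto
    ultimately show ?thesis
      using that(1) ab by (auto simp: frac_ideal_def submodule_of_iff[OF R])
  qed
  show ?thesis
  proof
    assume "invertible_frac_ideal R I"
    then show "I \<star> R = I \<and> (\<exists>J. J \<star> R = J \<and> I \<star> J = R)"
      unfolding invertible_frac_ideal_def frac_ideal_def submodule_of_iff[OF R] by blast
  next
    assume "I \<star> R = I \<and> (\<exists>J. J \<star> R = J \<and> I \<star> J = R)"
    then obtain J where J: "I \<star> R = I" "J \<star> R = J" "I \<star> J = R" by blast
    then show "invertible_frac_ideal R I"
      using frac[OF J] frac[OF J(2,1)] unfolding invertible_frac_ideal_def prod_span_commute[of J I]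
      by blast
  qed
qed

lemma invertibleI:
  assumes "domain_with_qf R" "I \<star> R = I" "J \<star> R = J" "I \<star> J = R"
  shows "invertible_frac_ideal R I"
  using assms by (auto simp: invertible_frac_ideal_iff)

lemma invertibleE:
  assumes "domain_with_qf R" "invertible_frac_ideal R I"
  obtains J where "I \<star> R = I" "J \<star> R = J" "I \<star> J = R" "invertible_frac_ideal R J"
proof -
  obtain J where J: "I \<star> R = I" "J \<star> R = J" "I \<star> J = R"
    using assms(2) unfolding invertible_frac_ideal_iff[OF assms(1)] by blast
  have "invertible_frac_ideal R J"
    by (rule invertibleI[OF assms(1) J(2,1)]) (subst prod_span_commute, rule J)
  with J show ?thesis by (rule that)
qed

lemma invertible_module:
  assumes "domain_with_qf R" "invertible_frac_ideal R I"
  shows "I \<star> R = I" "R \<star> I = I" "add_subgroup I"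
proof -
  show "I \<star> R = I" by (rule invertibleE[OF assms])
  then show "R \<star> I = I" "add_subgroup I"
    by (simp_all only: prod_span_commute[of R I]) (rule add_subgroup_of_module)
qed

lemma invertible_prod_span:
  assumes R: "domain_with_qf R" and "invertible_frac_ideal R I" "invertible_frac_ideal R J"
  shows "invertible_frac_ideal R (I \<star> J)"
proof -
  obtain I' where I: "I \<star> R = I" "I' \<star> R = I'" "I \<star> I' = R" by (rule invertibleE[OF assms(1,2)])
  obtain J' where J: "J \<star> R = J" "J' \<star> R = J'" "J \<star> J' = R" by (rule invertibleE[OF assms(1,3)])
  show ?thesis
  proof (rule invertibleI[OF R])
    have "I \<star> J \<star> (I' \<star> J') = (I \<star> I') \<star> (J \<star> J')" by (simp only: prod_span_ac)
    then show "I \<star> J \<star> (I' \<star> J') = R"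
      using I J domain_with_qfD(1)[OF R] prod_span_subring by simp
  qed (simp_all add: prod_span_assoc I J)
qed

lemma invertible_unit: "domain_with_qf R \<Longrightarrow> invertible_frac_ideal R R"
  by (rule invertibleI[where J = R]) (auto simp: prod_span_subring domain_with_qfD)

lemma invertible_principal:
  assumes "domain_with_qf R" "x \<noteq> 0"
  shows "invertible_frac_ideal R ({x} \<star> R)"
proof (rule invertibleI[OF assms(1), where J = "{inverse x} \<star> R"])
  note R = domain_with_qfD(1)[OF assms(1)]
  have "{x} \<star> R \<star> ({inverse x} \<star> R) = {x} \<star> ({inverse x} \<star> (R \<star> R))"
    by (simp only: prod_span_ac)
  then show "{x} \<star> R \<star> ({inverse x} \<star> R) = R"
    using R assms(2) by (simp add: prod_span_subring prod_span_singleton_cancel subring_ofD)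
qed (simp_all add: prod_span_assoc prod_span_subring domain_with_qfD assms)

lemma comm_group_InvIdeals:
  assumes "domain_with_qf R" shows "comm_group (InvIdeals R)"
proof (rule comm_groupI)
  fix I assume "I \<in> carrier (InvIdeals R)"
  then have "invertible_frac_ideal R I" by (simp add: InvIdeals_def)
  then obtain J where J: "I \<star> R = I" "J \<star> R = J" "I \<star> J = R" "invertible_frac_ideal R J"
    by (rule invertibleE[OF assms])
  then show "\<exists>J\<in>carrier (InvIdeals R). J \<otimes>\<^bsub>InvIdeals R\<^esub> I = \<one>\<^bsub>InvIdeals R\<^esub>"
    by (auto simp: InvIdeals_def prod_span_commute)
  show "\<one>\<^bsub>InvIdeals R\<^esub> \<otimes>\<^bsub>InvIdeals R\<^esub> I = I"
    using J by (simp add: InvIdeals_def prod_span_commute)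
qed (simp_all add: InvIdeals_def invertible_prod_span invertible_unit assms prod_span_assoc,
    simp add: prod_span_commute)

definition principal_ideals :: "'f::field set \<Rightarrow> 'f set set" where
  "principal_ideals R = {I. invertible_frac_ideal R I \<and> principal_frac_ideal R I}"

lemma principal_ideals_eq:
  assumes "domain_with_qf R"
  shows "principal_ideals R = (\<lambda>x. {x} \<star> R) ` (- {0})"
  using invertible_principal[OF assms]
  by (auto simp: principal_ideals_def principal_frac_ideal_def
      singleton_prod_span_eq[OF domain_with_qfD(1)[OF assms], symmetric])

lemma subgroup_principal_ideals:
  assumes "domain_with_qf R"
  shows "subgroup (principal_ideals R) (InvIdeals R)"
proof -
  interpret comm_group "InvIdeals R" by (rule comm_group_InvIdeals[OF assms])
  note R = domain_with_qfD(1)[OF assms]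
  have mult: "{x} \<star> R \<star> ({y} \<star> R) = {x * y} \<star> R" for x y
  proof -
    have "{x} \<star> R \<star> ({y} \<star> R) = {x} \<star> ({y} \<star> (R \<star> R))" by (simp only: prod_span_ac)
    then show ?thesis by (simp add: prod_span_subring[OF R] prod_span_singletons)
  qed
  have one: "{1} \<star> R = R" by (simp add: prod_span_one subring_ofD[OF R])
  show ?thesis
  proof (rule subgroupI)
    have "{1} \<star> R \<in> principal_ideals R"
      unfolding principal_ideals_eq[OF assms] by (rule imageI) simp
    then show "principal_ideals R \<noteq> {}" by blast
    show "principal_ideals R \<subseteq> carrier (InvIdeals R)"
      by (auto simp: principal_ideals_def InvIdeals_def)
  next
    fix I assume "I \<in> principal_ideals R"
    then obtain x where x: "x \<noteq> 0" "I = {x} \<star> R" by (auto simp: principal_ideals_eq[OF assms])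
    have "inv\<^bsub>InvIdeals R\<^esub> I = {inverse x} \<star> R"
      by (rule inv_equality)
        (use x one in \<open>simp_all add: InvIdeals_def mult invertible_principal assms\<close>)
    then show "inv\<^bsub>InvIdeals R\<^esub> I \<in> principal_ideals R"
      using x by (auto simp: principal_ideals_eq[OF assms])
  next
    fix I J assume "I \<in> principal_ideals R" "J \<in> principal_ideals R"
    then obtain x y where "x \<noteq> 0" "I = {x} \<star> R" "y \<noteq> 0" "J = {y} \<star> R"
      by (auto simp: principal_ideals_eq[OF assms])
    then have "I \<otimes>\<^bsub>InvIdeals R\<^esub> J = {x * y} \<star> R" "x * y \<noteq> 0"
      by (simp_all add: InvIdeals_def mult)
    then show "I \<otimes>\<^bsub>InvIdeals R\<^esub> J \<in> principal_ideals R"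
      unfolding principal_ideals_eq[OF assms] by blast
  qed
qed

lemma normal_principal_ideals:
  assumes "domain_with_qf R"
  shows "principal_ideals R \<lhd> InvIdeals R"
  using subgroup_principal_ideals[OF assms]
  by (simp add: comm_group.normal_iff_subgroup[OF comm_group_InvIdeals[OF assms]])

lemma Pic_alt: "Pic R = InvIdeals R Mod principal_ideals R"
  by (simp add: Pic_def principal_ideals_def)

lemma comm_group_Pic:
  assumes "domain_with_qf R" shows "comm_group (Pic R)"
  unfolding Pic_alt
  by (rule comm_group.abelian_FactGroup[OF comm_group_InvIdeals[OF assms] subgroup_principal_ideals[OF assms]])

definition pic_class :: "'f::field set \<Rightarrow> 'f set \<Rightarrow> 'f set set" where
  "pic_class R I = principal_ideals R #>\<^bsub>InvIdeals R\<^esub> I"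

lemma carrier_Pic: "carrier (Pic R) = pic_class R ` {I. invertible_frac_ideal R I}"
  by (simp add: Pic_alt carrier_FactGroup pic_class_def[abs_def]) (simp add: InvIdeals_def)

lemma pic_class_hom:
  assumes "domain_with_qf R"
  shows "pic_class R \<in> hom (InvIdeals R) (Pic R)"
  using normal.r_coset_hom_Mod[OF normal_principal_ideals[OF assms]]
  unfolding Pic_alt pic_class_def .

lemma pic_class_mult:
  assumes "domain_with_qf R" "invertible_frac_ideal R I" "invertible_frac_ideal R J"
  shows "pic_class R (I \<star> J) = pic_class R I \<otimes>\<^bsub>Pic R\<^esub> pic_class R J"
  using hom_mult[OF pic_class_hom[OF assms(1)], of I J] assms by (simp add: InvIdeals_def)

lemma pic_class_eq:
  assumes "domain_with_qf R" "invertible_frac_ideal R I"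
  shows "pic_class R I = (\<lambda>x. {x} \<star> I) ` (- {0})"
proof -
  have "{x} \<star> R \<star> I = {x} \<star> I" for x
    by (simp add: prod_span_assoc invertible_module[OF assms])
  then show ?thesis
    unfolding pic_class_def r_coset_def principal_ideals_eq[OF assms(1)] by (simp add: InvIdeals_def UNION_singleton_eq_range image_image)
qed

lemma pic_class_eq_iff:
  assumes "domain_with_qf R" "invertible_frac_ideal R I" "invertible_frac_ideal R J"
  shows "pic_class R I = pic_class R J \<longleftrightarrow> (\<exists>x. x \<noteq> 0 \<and> J = {x} \<star> I)"
proof
  have sub: "add_subgroup I" "add_subgroup J"
    by (rule invertible_module(3)[OF assms(1,2)], rule invertible_module(3)[OF assms(1,3)])
  have "J \<in> (\<lambda>x. {x} \<star> J) ` (- {0})"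
    using sub by (intro rev_image_eqI[of 1]) (simp_all add: prod_span_one)
  then have "J \<in> pic_class R J" by (simp only: pic_class_eq[OF assms(1,3)])
  then have "J \<in> (\<lambda>x. {x} \<star> I) ` (- {0})" if "pic_class R I = pic_class R J"
    using that pic_class_eq[OF assms(1,2)] by simp
  then show "\<exists>x. x \<noteq> 0 \<and> J = {x} \<star> I" if "pic_class R I = pic_class R J"
    using that by blast
  assume "\<exists>x. x \<noteq> 0 \<and> J = {x} \<star> I"
  then obtain x where x: "x \<noteq> 0" "J = {x} \<star> I" by blast
  have le: "pic_class R ({x} \<star> I) \<subseteq> pic_class R I" if "x \<noteq> 0" "invertible_frac_ideal R I"
    "invertible_frac_ideal R ({x} \<star> I)" for x I
    using that(1) unfolding pic_class_eq[OF assms(1) that(2)] pic_class_eq[OF assms(1) that(3)]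
      prod_span_singletons by auto
  have "I = {inverse x} \<star> J" using x sub by (simp add: prod_span_singleton_cancel)
  then show "pic_class R I = pic_class R J"
    using le[of x I] le[of "inverse x" J] x assms by auto
qed

lemma invertible_scale:
  assumes "domain_with_qf R" "invertible_frac_ideal R I" "x \<noteq> 0"
  shows "invertible_frac_ideal R ({x} \<star> I)"
proof -
  have "{x} \<star> I = ({x} \<star> R) \<star> I"
    by (simp add: prod_span_assoc invertible_module[OF assms(1,2)])
  then show ?thesis
    using invertible_prod_span[OF assms(1) invertible_principal[OF assms(1,3)] assms(2)] by simp
qed

lemma pic_class_scale:
  assumes "domain_with_qf R" "invertible_frac_ideal R I" "x \<noteq> 0"
  shows "pic_class R ({x} \<star> I) = pic_class R I"
  using pic_class_eq_iff[OF assms(1,2) invertible_scale[OF assms]] assms(3) by auto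

lemma pic_class_one: "pic_class R R = \<one>\<^bsub>Pic R\<^esub>" if "domain_with_qf R"
proof -
  interpret group_hom "InvIdeals R" "Pic R" "pic_class R"
    using pic_class_hom[OF that] comm_group_InvIdeals[OF that] comm_group_Pic[OF that]
    by (auto simp: group_hom_def group_hom_axioms_def comm_group_def)
  show ?thesis using hom_one by (simp add: InvIdeals_def)
qed

context unital_hom
begin

lemma image_scale: "h ` ({x} \<star> I) = {h x} \<star> h ` I"
  by (simp add: image_prod_span)

lemma invertible_extension:
  assumes "domain_with_qf R" "domain_with_qf S" "h ` R \<subseteq> S" "invertible_frac_ideal R I"
  shows "invertible_frac_ideal S (h ` I \<star> S)"
proof -
  obtain J where J: "I \<star> R = I" "J \<star> R = J" "I \<star> J = R"
    by (rule invertibleE[OF assms(1,4)])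
  note S = domain_with_qfD(1)[OF assms(2)]
  have SS: "S \<star> S = S" by (rule prod_span_subring[OF S])
  show ?thesis
  proof (rule invertibleI[OF assms(2), where J = "h ` J \<star> S"])
    have "h ` I \<star> S \<star> (h ` J \<star> S) = (h ` I \<star> h ` J) \<star> (S \<star> S)" by (simp only: prod_span_ac)
    also have "\<dots> = S \<star> h ` R" by (simp add: SS J flip: image_prod_span) (rule prod_span_commute)
    also have "\<dots> = S"
      using prod_span_overring[OF S] subring_of_image domain_with_qfD(1)[OF assms(1)] assms(3) by blast
    finally show "h ` I \<star> S \<star> (h ` J \<star> S) = S" .
  qed (simp_all add: prod_span_assoc SS)
qed

lemma extension_mult:
  assumes "subring_of S"
  shows "h ` (I \<star> J) \<star> S = (h ` I \<star> S) \<star> (h ` J \<star> S)"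
proof -
  have "(h ` I \<star> S) \<star> (h ` J \<star> S) = (h ` I \<star> h ` J) \<star> (S \<star> S)" by (simp only: prod_span_ac)
  then show ?thesis by (simp add: image_prod_span prod_span_subring[OF assms])
qed

end

section \<open>Flat overrings\<close>

locale flat_overring =
  fixes D T :: "'k::field set"
  assumes D: "domain_with_qf D" and T: "overring D T" and flat: "flat_over D T"
begin

lemma subring_D: "subring_of D" and subring_T: "subring_of T" and D_sub_T: "D \<subseteq> T"
  using domain_with_qfD(1)[OF D] T by (auto simp: overring_def)

lemma domain_T: "domain_with_qf T"
  using D D_sub_T subring_T unfolding domain_with_qf_def by blast

text \<open>The equational criterion is applied to the relation
  \<open>b * t + (- a) * 1 = 0\<close>, where \<open>t = a / b\<close>. Cancelling \<open>b\<close>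
  in the resulting coefficient relations shows that each coefficient of \<open>1\<close> multiplies
  \<open>t\<close> into \<open>D\<close>, so the expansion of \<open>1\<close> lies in the ideal of
  denominators times \<open>T\<close>.\<close>

lemma one_mem_denominators:
  assumes "t \<in> T" shows "1 \<in> {d \<in> D. d * t \<in> D} \<star> T"
proof -
  obtain a b where ab: "a \<in> D" "b \<in> D" "b \<noteq> 0" "t = a / b"
    using domain_with_qfD(2)[OF D] by blast
  define \<alpha> x where "\<alpha> = (\<lambda>i::nat. if i = 0 then b else - a)" and "x = (\<lambda>i::nat. if i = 0 then t else 1)"
  have "(\<forall>i<2. \<alpha> i \<in> D \<and> x i \<in> T) \<and> (\<Sum>i<2. \<alpha> i * x i) = 0"
    using ab assms subring_ofD[OF subring_D] subring_ofD(2)[OF subring_T]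
    by (simp add: \<alpha>_def x_def lessThan_Suc numeral_2_eq_2)
  then obtain m :: nat and y \<beta> where y: "\<forall>j<m. y j \<in> T" "\<forall>i<2. \<forall>j<m. \<beta> i j \<in> D"
    "\<forall>i<2. x i = (\<Sum>j<m. \<beta> i j * y j)" "\<forall>j<m. (\<Sum>i<2. \<alpha> i * \<beta> i j) = 0"
    using flat unfolding flat_over_def by blast
  have "\<beta> 1 j * y j \<in> {d \<in> D. d * t \<in> D} \<star> T" if "j < m" for j
  proof (rule prod_span_mem)
    have "b * \<beta> 0 j - a * \<beta> 1 j = 0"
      using y(4) that by (simp add: \<alpha>_def lessThan_Suc numeral_2_eq_2)
    moreover have "a = b * t" using ab(3,4) by simp
    ultimately have "b * \<beta> 0 j = b * (\<beta> 1 j * t)" by (simp add: mult_ac)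
    then have "\<beta> 1 j * t = \<beta> 0 j" using ab(3) by simp
    then show "\<beta> 1 j \<in> {d \<in> D. d * t \<in> D}" using y(2) that by simp
  qed (use y(1) that in blast)
  then have "(\<Sum>j<m. \<beta> 1 j * y j) \<in> {d \<in> D. d * t \<in> D} \<star> T"
    by (intro add_subgroup_sum add_subgroup_prod_span) auto
  moreover have "x 1 = (\<Sum>j<m. \<beta> 1 j * y j)" using y(3) by simp
  ultimately show ?thesis by (simp add: x_def)
qed

text \<open>The ideals of \<open>D\<close> that extend to the unit ideal are closed under products
  and enlargement. This stands in for multiplying two denominators.\<close>

lemma one_mem_ideal_mult:
  assumes "1 \<in> I \<star> T" "1 \<in> J \<star> T" "I \<star> J \<subseteq> L"
  shows "1 \<in> L \<star> T"
proof -
  have "1 * 1 \<in> (I \<star> T) \<star> (J \<star> T)" using assms(1,2) by (rule prod_span_mem)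
  also have "(I \<star> T) \<star> (J \<star> T) = (I \<star> J) \<star> (T \<star> T)" by (simp only: prod_span_ac)
  also have "\<dots> \<subseteq> L \<star> T"
    unfolding prod_span_subring[OF subring_T] using assms(3) by (rule prod_span_mono) simp
  finally show ?thesis by simp
qed

end

locale flat_overring_hom = flat_overring D T + unital_hom h
  for D T :: "'k::field set" and h :: "'k \<Rightarrow> 'l::field"
begin

text \<open>The elements \<open>x\<close> with this property form an additive subgroup, where a sum
  is handled by multiplying the conductors of its two terms. The subgroup contains every
  \<open>m * h t\<close>, because a denominator of \<open>t\<close> lies in the conductor of
  \<open>m * h t\<close>.\<close>

lemma one_mem_colon:
  assumes M: "M \<star> h ` D = M" and x: "x \<in> M \<star> h ` T"
  shows "1 \<in> {d \<in> D. h d * x \<in> M} \<star> T"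
proof -
  note subM = add_subgroupD[OF add_subgroup_of_module[OF M]]
  have "add_subgroup {x. 1 \<in> {d \<in> D. h d * x \<in> M} \<star> T}"
  proof (rule add_subgroupI)
    have "1 * 1 \<in> D \<star> T" using subring_ofD(2) subring_D subring_T by (intro prod_span_mem) auto
    then show "0 \<in> {x. 1 \<in> {d \<in> D. h d * x \<in> M} \<star> T}" using subM(1) by simp
  next
    fix x y
    assume "x \<in> {x. 1 \<in> {d \<in> D. h d * x \<in> M} \<star> T}" "y \<in> {x. 1 \<in> {d \<in> D. h d * x \<in> M} \<star> T}"
    then have xy: "1 \<in> {d \<in> D. h d * x \<in> M} \<star> T" "1 \<in> {d \<in> D. h d * y \<in> M} \<star> T" by auto
    have "add_subgroup {d \<in> D. h d * (x + y) \<in> M}"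
      using subM subring_ofD[OF subring_D]
      by (intro add_subgroupI) (simp_all add: hom_zero hom_add hom_minus distrib_right)
    then have "{d \<in> D. h d * x \<in> M} \<star> {d \<in> D. h d * y \<in> M} \<subseteq> {d \<in> D. h d * (x + y) \<in> M}"
    proof (rule prod_span_least)
      fix a b assume ab: "a \<in> {d \<in> D. h d * x \<in> M}" "b \<in> {d \<in> D. h d * y \<in> M}"
      have "(h a * x) * h b \<in> M" "(h b * y) * h a \<in> M"
        using ab by (auto intro: module_scale[OF M])
      then have "(h a * x) * h b + (h b * y) * h a \<in> M" by (rule subM(2))
      then have "h (a * b) * (x + y) \<in> M" by (simp add: hom_mult algebra_simps)
      then show "a * b \<in> {d \<in> D. h d * (x + y) \<in> M}" using ab subring_ofD(4)[OF subring_D] by auto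
    qed
    then show "x + y \<in> {x. 1 \<in> {d \<in> D. h d * x \<in> M} \<star> T}"
      using one_mem_ideal_mult[OF xy] by simp
  next
    fix x assume x: "x \<in> {x. 1 \<in> {d \<in> D. h d * x \<in> M} \<star> T}"
    have "{d \<in> D. h d * - x \<in> M} = {d \<in> D. h d * x \<in> M}" using subM(3) by force
    then show "- x \<in> {x. 1 \<in> {d \<in> D. h d * x \<in> M} \<star> T}" using x by simp
  qed
  then have "M \<star> h ` T \<subseteq> {x. 1 \<in> {d \<in> D. h d * x \<in> M} \<star> T}"
  proof (rule prod_span_least)
    fix m b assume m: "m \<in> M" and "b \<in> h ` T"
    then obtain t where t: "t \<in> T" "b = h t" by blast
    have "{d \<in> D. d * t \<in> D} \<subseteq> {d \<in> D. h d * (m * b) \<in> M}"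
    proof
      fix d assume d: "d \<in> {d \<in> D. d * t \<in> D}"
      then have "m * h (d * t) \<in> M" using m by (auto intro: module_scale[OF M])
      then show "d \<in> {d \<in> D. h d * (m * b) \<in> M}" using d t by (simp add: hom_mult mult_ac)
    qed
    then show "m * b \<in> {x. 1 \<in> {d \<in> D. h d * x \<in> M} \<star> T}"
      using one_mem_denominators[OF t(1)] prod_span_mono by blast
  qed
  then show ?thesis using x by blast
qed

end

sublocale flat_overring \<subseteq> flat_overring_hom D T "\<lambda>x. x"
  by (intro flat_overring_hom.intro flat_overring_axioms unital_hom_id)

text \<open>\<open>D \<inter> A\<close> is the conductor of \<open>1\<close> in \<open>A\<close>, so
  this is \<open>one_mem_colon\<close> at \<open>x = 1\<close>.\<close>

lemma (in flat_overring) one_mem_contraction: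
  assumes "A \<star> D = A" "1 \<in> A \<star> T"
  shows "1 \<in> (D \<inter> A) \<star> T"
  using one_mem_colon[of A 1] assms by (simp add: Int_def)

text \<open>The elements of \<^term>\<open>T\<close> with a power in an ideal form an additive group.\<close>

lemma one_mem_of_powers:
  assumes T: "subring_of T" and A: "A \<star> T = A" and C: "C \<subseteq> T"
    and pow: "\<And>c. c \<in> C \<Longrightarrow> c ^ n \<in> A" and one: "1 \<in> C \<star> T"
  shows "1 \<in> A"
proof -
  note subA = add_subgroupD[OF add_subgroup_of_module[OF A]]
  let ?R = "{x \<in> T. \<exists>n. x ^ n \<in> A}"
  have "add_subgroup ?R"
  proof (rule add_subgroupI)
    have "(0::'a) ^ 1 \<in> A" using subA(1) by simp
    then show "0 \<in> ?R" using subring_ofD(1)[OF T] by blast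
  next
    fix x y assume "x \<in> ?R" "y \<in> ?R"
    then obtain m n where xy: "x \<in> T" "y \<in> T" "x ^ m \<in> A" "y ^ n \<in> A" by blast
    \<comment> \<open>Either \<open>k \<ge> m\<close> or \<open>m + n - k \<ge> n\<close>, so
      \<open>x ^ m\<close> or \<open>y ^ n\<close> splits off each term of the binomial
      expansion.\<close>
    have "of_nat (m + n choose k) * x ^ k * y ^ (m + n - k) \<in> A" if "k \<le> m + n" for k
    proof (cases "m \<le> k")
      case True
      have "x ^ m * (of_nat (m + n choose k) * x ^ (k - m) * y ^ (m + n - k)) \<in> A"
        by (intro module_scale[OF A] xy subring_ofD(4,8,9)[OF T])
      also have "x ^ m * (of_nat (m + n choose k) * x ^ (k - m) * y ^ (m + n - k))
        = of_nat (m + n choose k) * (x ^ m * x ^ (k - m)) * y ^ (m + n - k)" by (simp add: mult_ac)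
      finally show ?thesis using True by (simp flip: power_add)
    next
      case False
      have "y ^ n * (of_nat (m + n choose k) * x ^ k * y ^ (m - k)) \<in> A"
        by (intro module_scale[OF A] xy subring_ofD(4,8,9)[OF T])
      also have "y ^ n * (of_nat (m + n choose k) * x ^ k * y ^ (m - k))
        = of_nat (m + n choose k) * x ^ k * (y ^ n * y ^ (m - k))" by (simp add: mult_ac)
      finally show ?thesis using False by (simp flip: power_add) (simp add: add.commute)
    qed
    then have "(x + y) ^ (m + n) \<in> A"
      unfolding binomial_ring by (intro add_subgroup_sum add_subgroup_of_module[OF A]) auto
    then show "x + y \<in> ?R" using xy subring_ofD(3)[OF T] by blast
  next
    fix x assume "x \<in> ?R"
    then obtain m where x: "x \<in> T" "x ^ m \<in> A" by blast
    have "x ^ m * (- 1) ^ m \<in> A"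
      by (intro module_scale[OF A] x subring_ofD(2,5,8)[OF T])
    then have "(- x) ^ m \<in> A" by (subst power_minus) (simp add: mult.commute)
    then show "- x \<in> ?R" using x subring_ofD(5)[OF T] by blast
  qed
  then have "C \<star> T \<subseteq> ?R"
  proof (rule prod_span_least)
    fix c t assume ct: "c \<in> C" "t \<in> T"
    have "c ^ n * t ^ n \<in> A" by (intro module_scale[OF A] pow ct subring_ofD(8)[OF T])
    then show "c * t \<in> ?R"
      using C ct subring_ofD(4)[OF T] by (auto simp flip: power_mult_distrib)
  qed
  then obtain m where "(1::'a) ^ m \<in> A" using one by blast
  then show ?thesis by simp
qed

section \<open>Integer-valued polynomials\<close>

lemma IntPoly_closed:
  assumes "subring_of A"
  shows "0 \<in> IntPoly A" "1 \<in> IntPoly A" "f \<in> IntPoly A \<Longrightarrow> g \<in> IntPoly A \<Longrightarrow> f + g \<in> IntPoly A"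
    "f \<in> IntPoly A \<Longrightarrow> g \<in> IntPoly A \<Longrightarrow> f * g \<in> IntPoly A" "f \<in> IntPoly A \<Longrightarrow> - f \<in> IntPoly A"
    "c \<in> A \<Longrightarrow> [:c:] \<in> IntPoly A" "c \<in> A \<Longrightarrow> f \<in> IntPoly A \<Longrightarrow> Polynomial.smult c f \<in> IntPoly A"
    "f \<in> IntPoly A \<Longrightarrow> g \<in> IntPoly A \<Longrightarrow> f - g \<in> IntPoly A"
  using subring_ofD[OF assms] by (auto simp: IntPoly_def)

lemma poly_mem_of_coeffs:
  assumes "subring_of A" "\<And>i. Polynomial.coeff p i \<in> A" "a \<in> A"
  shows "poly p a \<in> A"
  unfolding poly_altdef
  by (intro add_subgroup_sum subring_ofD(4,7,8)[OF assms(1)] assms(2,3))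

text \<open>Induction on the degree: \<open>f(sX) - s^n f(X)\<close> has degree smaller than \<open>n = deg f\<close>, and \<open>f(st)\<close> is
  integral as soon as \<open>s\<close> is a denominator of \<open>t\<close>.\<close>

lemma (in flat_overring) IntPoly_subset: "IntPoly D \<subseteq> IntPoly T"
proof
  fix f assume "f \<in> IntPoly D"
  then show "f \<in> IntPoly T"
  proof (induction "Polynomial.degree f" arbitrary: f rule: less_induct)
    case less
    show ?case
    proof (cases "Polynomial.degree f = 0")
      case True
      then obtain c where c: "f = [:c:]" by (rule degree_eq_zeroE)
      then have "c \<in> D" using less.prems subring_ofD(1)[OF subring_D] by (auto simp: IntPoly_def)
      then show ?thesis using c D_sub_T IntPoly_closed(6)[OF subring_T] by blast
    next
      case False
      define n where "n = Polynomial.degree f"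
      have powers: "s ^ n * poly f t \<in> T" if s: "s \<in> D" "s * t \<in> D" and t: "t \<in> T" for s t
      proof -
        define g where "g = pcompose f [:0, s:] - Polynomial.smult (s ^ n) f"
        have "Polynomial.coeff g i = 0" if "i \<ge> n" for i
          using that coeff_eq_0[of f i] by (cases "i = n") (auto simp: g_def n_def coeff_pcompose_linear)
        \<comment> \<open>If \<open>g = 0\<close> its degree is \<open>0\<close>, which is smaller
          than \<open>n\<close> because the constant case has been split off.\<close>
        then have "Polynomial.degree g < Polynomial.degree f"
          using False unfolding n_def by (metis leading_coeff_0_iff degree_0 linorder_not_le neq0_conv)
        moreover have "g \<in> IntPoly D"
          using less.prems s(1) subring_ofD[OF subring_D]
          by (auto simp: g_def IntPoly_def poly_pcompose)
        ultimately have "poly g t \<in> T" using less.hyps[of g] t by (auto simp: IntPoly_def)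
        moreover have "poly f (s * t) \<in> T" using less.prems s(2) D_sub_T by (auto simp: IntPoly_def)
        ultimately have "poly f (s * t) - poly g t \<in> T" by (intro subring_ofD(6)[OF subring_T])
        then show ?thesis by (simp add: g_def poly_pcompose mult.commute)
      qed
      have "poly f t \<in> T" if t: "t \<in> T" for t
      proof -
        \<comment> \<open>\<open>?A\<close> is the conductor of \<open>poly f t\<close> in
          \<open>T\<close>. It contains the \<open>n\<close>-th power of each denominator of
          \<open>t\<close>, and since the denominators generate the unit ideal of \<open>T\<close>,
          so do these powers.\<close>
        let ?A = "{u \<in> T. u * poly f t \<in> T}"
        have "1 \<in> ?A"
        proof (rule one_mem_of_powers[OF subring_T])
          show "?A \<star> T = ?A"
            using subring_ofD[OF subring_T]
            by (intro prod_span_idI subring_T add_subgroupI)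
              (auto simp: distrib_right, metis mult.assoc mult.commute)
          show "1 \<in> {d \<in> D. d * t \<in> D} \<star> T" by (rule one_mem_denominators[OF t])
          show "c ^ n \<in> ?A" if "c \<in> {d \<in> D. d * t \<in> D}" for c
            using that powers t D_sub_T subring_ofD(8)[OF subring_T] by auto
        qed (use D_sub_T in blast)
        then show ?thesis by simp
      qed
      then show ?thesis by (simp add: IntPoly_def)
    qed
  qed
qed

section \<open>Integer-valued polynomials inside \<open>K(X)\<close>\<close>

definition poly_fract :: "'k::field poly \<Rightarrow> 'k poly fract" where
  "poly_fract p = Fract p 1"

lemma poly_fract_simps:
  "poly_fract 0 = 0" "poly_fract 1 = 1" "poly_fract (p + q) = poly_fract p + poly_fract q"
  "poly_fract (p * q) = poly_fract p * poly_fract q" "poly_fract (- p) = - poly_fract p"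
  "poly_fract (p - q) = poly_fract p - poly_fract q"
  "poly_fract [:c:] = const_fract c" "poly_fract (Polynomial.smult c p) = const_fract c * poly_fract p"
  by (simp_all add: poly_fract_def const_fract_def Zero_fract_def One_fract_def)

lemma poly_fract_inject: "poly_fract p = poly_fract q \<longleftrightarrow> p = q"
  by (simp add: poly_fract_def eq_fract)

lemma poly_fract_eq_0_iff: "poly_fract p = 0 \<longleftrightarrow> p = 0"
  using poly_fract_inject[of p 0] by (simp add: poly_fract_simps)

lemma unital_hom_const_fract: "unital_hom const_fract"
  by unfold_locales (simp_all add: one_pCons mult.commute flip: poly_fract_simps(2,3,4,7))

interpretation const: unital_hom const_fract
  by (rule unital_hom_const_fract)

lemma IntR_alt: "IntR A = poly_fract ` IntPoly A"
  by (simp add: IntR_def poly_fract_def[abs_def])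

lemma poly_fract_mem_IntR: "poly_fract p \<in> IntR A \<longleftrightarrow> p \<in> IntPoly A"
  by (auto simp: IntR_alt poly_fract_inject)

text \<open>For the field as its own domain, \<open>IntR\<close> is the polynomial ring
  \<open>K[X]\<close>, which therefore appears as \<open>IntR UNIV\<close> from here on.\<close>

lemma IntR_UNIV: "IntR UNIV = range poly_fract"
  by (simp add: IntR_alt IntPoly_def)

lemma IntR_subset_UNIV: "IntR A \<subseteq> IntR UNIV"
  unfolding IntR_UNIV by (auto simp: IntR_alt)

lemma subring_IntR:
  assumes "subring_of A" shows "subring_of (IntR A)"
  using IntPoly_closed(1-5)[OF assms] unfolding subring_of_def IntR_alt
  by (auto simp: image_iff simp flip: poly_fract_simps(3-5)) (metis poly_fract_simps(1,2))+

lemma const_fract_mem_IntR: "subring_of A \<Longrightarrow> c \<in> A \<Longrightarrow> const_fract c \<in> IntR A"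
  using IntPoly_closed(6) by (metis poly_fract_mem_IntR poly_fract_simps(7))

lemma const_fract_image_subset: "subring_of A \<Longrightarrow> const_fract ` A \<subseteq> IntR A"
  by (auto intro: const_fract_mem_IntR)

lemma prod_span_const_fract_IntR:
  assumes "subring_of A" shows "const_fract ` A \<star> IntR A = IntR A"
  unfolding prod_span_commute[of "const_fract ` A"]
  by (intro prod_span_overring subring_IntR const.subring_of_image const_fract_image_subset assms)

lemma common_denominator:
  assumes "domain_with_qf D"
  shows "\<exists>d\<in>D. d \<noteq> 0 \<and> (\<forall>i. Polynomial.coeff (Polynomial.smult d p) i \<in> D)"
proof (induction p)
  case 0
  show ?case using subring_ofD(1,2)[OF domain_with_qfD(1)[OF assms]] by (intro bexI[of _ 1]) auto
next
  case (pCons c p)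
  note D = subring_ofD[OF domain_with_qfD(1)[OF assms]]
  obtain d where d: "d \<in> D" "d \<noteq> 0" "\<And>i. Polynomial.coeff (Polynomial.smult d p) i \<in> D" using pCons.IH by blast
  obtain a b where ab: "a \<in> D" "b \<in> D" "b \<noteq> 0" "c = a / b"
    using domain_with_qfD(2)[OF assms] by blast
  have "Polynomial.coeff (Polynomial.smult (d * b) (pCons c p)) i \<in> D" for i
  proof (cases i)
    case 0
    then show ?thesis using ab d D(4) by simp
  next
    case (Suc j)
    have "b * Polynomial.coeff (Polynomial.smult d p) j \<in> D" using ab d by (intro D)
    then show ?thesis using Suc by (simp add: mult_ac)
  qed
  then show ?case using ab d D(4) by (intro bexI[of _ "d * b"]) auto
qed

lemma coeffs_IntPoly: "subring_of A \<Longrightarrow> (\<And>i. Polynomial.coeff p i \<in> A) \<Longrightarrow> p \<in> IntPoly A"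
  by (auto simp: IntPoly_def intro: poly_mem_of_coeffs)

lemma IntPoly_denominator:
  assumes "domain_with_qf D"
  shows "\<exists>d\<in>D. d \<noteq> 0 \<and> Polynomial.smult d p \<in> IntPoly D"
  using common_denominator[OF assms, of p] coeffs_IntPoly[OF domain_with_qfD(1)[OF assms]] by blast

lemma domain_IntR:
  assumes "domain_with_qf A" shows "domain_with_qf (IntR A)"
  unfolding domain_with_qf_def
proof (intro conjI allI)
  note A = domain_with_qfD(1)[OF assms]
  show "subring_of (IntR A)" by (rule subring_IntR[OF A])
  fix z :: "'a poly fract"
  obtain a b where z: "z = Fract a b" "b \<noteq> 0" by (cases z)
  obtain d e where d: "d \<in> A" "d \<noteq> 0" "Polynomial.smult d a \<in> IntPoly A" and e: "e \<in> A" "e \<noteq> 0" "Polynomial.smult e b \<in> IntPoly A"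
    using IntPoly_denominator[OF assms] by metis
  have "z = poly_fract (Polynomial.smult e (Polynomial.smult d a)) / poly_fract (Polynomial.smult d (Polynomial.smult e b))"
    using z d e by (simp add: poly_fract_def eq_fract mult.commute)
  moreover have "poly_fract (Polynomial.smult e (Polynomial.smult d a)) \<in> IntR A" "poly_fract (Polynomial.smult d (Polynomial.smult e b)) \<in> IntR A"
    using d e by (auto simp only: poly_fract_mem_IntR intro: IntPoly_closed(7)[OF A])
  moreover have "poly_fract (Polynomial.smult d (Polynomial.smult e b)) \<noteq> 0"
    using d e z by (simp add: poly_fract_eq_0_iff del: smult_smult)
  ultimately show "\<exists>a\<in>IntR A. \<exists>b\<in>IntR A. b \<noteq> 0 \<and> z = a / b" by blast
qed

lemma domain_UNIV: "domain_with_qf UNIV"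
proof -
  have "\<exists>a b. b \<noteq> 0 \<and> z = a / b" for z :: 'a by (intro exI[of _ z] exI[of _ 1]) simp
  then show ?thesis by (simp add: domain_with_qf_def subring_of_def)
qed

text \<open>Evaluation at \<open>0\<close> sends the extension of \<open>I\<close> into
  \<open>I\<close>, since integer-valued polynomials take values in \<open>A\<close> at
  \<open>0\<close>; a constant equals its own value.\<close>

lemma contraction_extension:
  assumes "subring_of A" "I \<star> A = I" "const_fract c \<in> const_fract ` I \<star> IntR A"
  shows "c \<in> I"
proof -
  note subI = add_subgroupD[OF add_subgroup_of_module[OF assms(2)]]
  let ?M = "poly_fract ` {p. poly p 0 \<in> I}"
  have "add_subgroup ?M"
    using subI rev_image_eqI[of 0 "{p. poly p 0 \<in> I}" 0 poly_fract]
    by (intro add_subgroupI) (auto simp: poly_fract_simps(1) simp flip: poly_fract_simps(3,5))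
  then have "const_fract ` I \<star> IntR A \<subseteq> ?M"
  proof (rule prod_span_least)
    fix a b assume "a \<in> const_fract ` I" "b \<in> IntR A"
    then obtain i f where if_: "i \<in> I" "a = const_fract i" "f \<in> IntPoly A" "b = poly_fract f"
      by (auto simp: IntR_alt)
    then have "a * b = poly_fract (Polynomial.smult i f)" by (simp add: poly_fract_simps)
    moreover have "i * poly f 0 \<in> I"
      using if_ subring_ofD(1)[OF assms(1)] by (intro module_scale[OF assms(2)]) (auto simp: IntPoly_def)
    ultimately show "a * b \<in> ?M" by simp
  qed
  then obtain p where "poly_fract [:c:] = poly_fract p" "poly p 0 \<in> I"
    using assms(3) by (auto simp: poly_fract_simps)
  then show ?thesis by (auto simp: poly_fract_inject)
qed

lemma extension_inject:
  assumes "subring_of A" "I \<star> A = I" "J \<star> A = J"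
    and "const_fract ` I \<star> IntR A = const_fract ` J \<star> IntR A"
  shows "I = J"
proof -
  have *: "I \<subseteq> J" if "I \<star> A = I" "J \<star> A = J"
    "const_fract ` I \<star> IntR A = const_fract ` J \<star> IntR A" for I J
  proof
    fix c assume "c \<in> I"
    then have "const_fract c \<in> const_fract ` I \<star> IntR A"
      using subset_prod_span_one[OF subring_ofD(2)[OF subring_IntR[OF assms(1)]], of "const_fract ` I"]
      by blast
    then show "c \<in> J" unfolding that(3) by (rule contraction_extension[OF assms(1) that(2)])
  qed
  show ?thesis using *[OF assms(2-4)] *[OF assms(3,2) assms(4)[symmetric]] by (rule subset_antisym)
qed

section \<open>Normalization of invertible ideals\<close>

lemma subring_KX: "subring_of (IntR UNIV)"
  by (intro subring_IntR domain_with_qfD(1) domain_UNIV)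

lemma prod_span_IntR_KX:
  assumes "subring_of A" shows "IntR A \<star> IntR UNIV = IntR UNIV"
  unfolding prod_span_commute[of "IntR A"]
  by (intro prod_span_overring subring_KX subring_IntR assms IntR_subset_UNIV)

text \<open>Multiplication by a common denominator \<open>d\<close> turns \<open>M\<close> into a
  nonzero ideal of \<open>K[X]\<close>, and division with remainder by an element \<open>g\<close>
  of least degree shows that \<open>g\<close> generates it.\<close>

lemma invertible_KX_principal:
  assumes "invertible_frac_ideal (IntR UNIV) M"
  shows "\<exists>g. g \<noteq> 0 \<and> M = {g} \<star> IntR UNIV"
proof -
  have M: "M \<star> IntR UNIV = M" "M \<noteq> {0}" and "\<exists>d\<in>IntR UNIV. d \<noteq> 0 \<and> (\<forall>x\<in>M. d * x \<in> IntR UNIV)"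
    using assms unfolding invertible_frac_ideal_def frac_ideal_def submodule_of_iff[OF subring_KX]
    by blast+
  then obtain d where d: "d \<noteq> 0" "\<And>x. x \<in> M \<Longrightarrow> d * x \<in> range poly_fract" by (auto simp: IntR_UNIV)
  note subM = add_subgroupD[OF add_subgroup_of_module[OF M(1)]]
  have "\<exists>x\<in>M. x \<noteq> 0" using M(2) subM(1) by blast
  then obtain x p where "x \<in> M" "x \<noteq> 0" "d * x = poly_fract p" using d(2) by blast
  then have "inverse d * poly_fract p \<in> M" "p \<noteq> 0"
    using d(1) by (auto simp: poly_fract_simps(1) simp flip: mult.assoc dest!: sym[of "d * x"])
  then have "\<exists>g. g \<noteq> 0 \<and> inverse d * poly_fract g \<in> M \<and>
      (\<forall>q. q \<noteq> 0 \<and> inverse d * poly_fract q \<in> M \<longrightarrow> Polynomial.degree g \<le> Polynomial.degree q)"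
    using ex_has_least_nat[of "\<lambda>g. g \<noteq> 0 \<and> inverse d * poly_fract g \<in> M" p Polynomial.degree] by blast
  then obtain g where g: "g \<noteq> 0" "inverse d * poly_fract g \<in> M"
    "\<And>q. q \<noteq> 0 \<Longrightarrow> inverse d * poly_fract q \<in> M \<Longrightarrow> Polynomial.degree g \<le> Polynomial.degree q" by blast
  have "{inverse d * poly_fract g} \<star> IntR UNIV = M"
  proof
    show "{inverse d * poly_fract g} \<star> IntR UNIV \<subseteq> M"
      using prod_span_mono[of "{inverse d * poly_fract g}" M "IntR UNIV"] g(2) M(1) by auto
    show "M \<subseteq> {inverse d * poly_fract g} \<star> IntR UNIV"
    proof
      fix x assume x: "x \<in> M"
      then obtain q where "d * x = poly_fract q" using d(2) by blast
      then have q: "x = inverse d * poly_fract q" using d(1) by (metis left_inverse mult.assoc mult_1)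
      have "inverse d * poly_fract g * poly_fract (q div g) \<in> M"
        by (intro module_scale[OF M(1)] g(2)) (simp add: IntR_UNIV)
      then have "x - inverse d * poly_fract g * poly_fract (q div g) \<in> M" by (rule subM(4)[OF x])
      also have "x - inverse d * poly_fract g * poly_fract (q div g)
          = inverse d * poly_fract (q - g * (q div g))"
        by (simp add: q poly_fract_simps algebra_simps)
      also have "q - g * (q div g) = q mod g" by (simp add: minus_mult_div_eq_mod)
      finally have "inverse d * poly_fract (q mod g) \<in> M" .
      then have "q mod g = 0" using g(3)[of "q mod g"] degree_mod_less[OF g(1), of q] by linarith
      then have "q = g * (q div g)" by (simp add: minus_mod_eq_mult_div[symmetric])
      then have "x = inverse d * poly_fract g * poly_fract (q div g)"
        using q by (metis mult.assoc poly_fract_simps(4))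
      then show "x \<in> {inverse d * poly_fract g} \<star> IntR UNIV"
        by (auto simp: IntR_UNIV intro!: prod_span_mem)
    qed
  qed
  then show ?thesis using g(1) d(1) by (intro exI[of _ "inverse d * poly_fract g"]) (simp add: poly_fract_eq_0_iff)
qed

text \<open>Such an \<open>x\<close> is a unit of \<open>K[X]\<close>, and degrees add, so it is a
  constant. This is what later forces factors from \<open>K(X)\<close> down into
  \<open>K\<close>.\<close>

lemma scale_KX_constant:
  assumes "{x} \<star> IntR UNIV = IntR UNIV"
  shows "\<exists>u. u \<noteq> 0 \<and> x = const_fract u"
proof -
  have eq: "(\<lambda>m. x * m) ` IntR UNIV = IntR UNIV"
    using assms singleton_prod_span[OF subring_ofD(7)[OF subring_KX]] by metis
  have one: "1 \<in> IntR UNIV" by (rule subring_ofD(2)[OF subring_KX])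
  have "x * 1 \<in> IntR UNIV" using one eq by blast
  then obtain p where p: "x = poly_fract p" by (auto simp: IntR_UNIV)
  have "1 \<in> (\<lambda>m. x * m) ` IntR UNIV" using one eq by simp
  then obtain q where "1 = x * poly_fract q" by (auto simp: IntR_UNIV)
  then have "p * q = 1"
    using p poly_fract_inject[of 1 "p * q"] by (simp add: poly_fract_simps)
  then have "p \<noteq> 0" "q \<noteq> 0" "Polynomial.degree (p * q) = 0" by auto
  then have "Polynomial.degree p = 0" by (simp add: degree_mult_eq)
  then obtain u where "p = [:u:]" by (rule degree_eq_zeroE)
  then show ?thesis using p \<open>p \<noteq> 0\<close> by (auto simp: poly_fract_simps)
qed

text \<open>A nonzero constant is a unit of \<open>K[X]\<close>. Ideals of constants thus become
  trivial there, and only a scalar factor remains visible.\<close>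

lemma const_extension_KX:
  assumes "c \<in> I" "c \<noteq> 0"
  shows "const_fract ` I \<star> IntR UNIV = IntR UNIV"
proof
  show "const_fract ` I \<star> IntR UNIV \<subseteq> IntR UNIV"
    using prod_span_mono[of "const_fract ` I" "IntR UNIV" "IntR UNIV" "IntR UNIV"]
      prod_span_subring[OF subring_KX] const_fract_image_subset[of UNIV] domain_with_qfD(1)[OF domain_UNIV]
    by auto
  show "IntR UNIV \<subseteq> const_fract ` I \<star> IntR UNIV"
  proof
    fix x :: "'a poly fract" assume "x \<in> IntR UNIV"
    then obtain p where p: "x = poly_fract p" by (auto simp: IntR_UNIV)
    have "const_fract c * poly_fract (Polynomial.smult (inverse c) p) \<in> const_fract ` I \<star> IntR UNIV"
      using assms(1) by (intro prod_span_mem) (auto simp: IntR_UNIV)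
    also have "const_fract c * poly_fract (Polynomial.smult (inverse c) p) = poly_fract (Polynomial.smult c (Polynomial.smult (inverse c) p))"
      by (simp only: poly_fract_simps(8))
    finally show "x \<in> const_fract ` I \<star> IntR UNIV" using p assms(2) by simp
  qed
qed

text \<open>\<open>K[X]\<close> arises from \<open>Int(A)\<close> by inverting the nonzero constants
  of \<open>A\<close>. Every element of \<open>J K[X]\<close>, and in particular \<open>1\<close>,
  therefore enters \<open>J\<close> after multiplication by such a constant.\<close>

lemma constant_in_ideal:
  fixes A :: "'k::field set"
  assumes A: "domain_with_qf A" and J: "J \<star> IntR A = J" and one: "1 \<in> J \<star> IntR UNIV"
  shows "\<exists>d\<in>A. d \<noteq> 0 \<and> const_fract d \<in> J"
proof -
  note subA = subring_ofD[OF domain_with_qfD(1)[OF A]]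
  note subJ = add_subgroupD[OF add_subgroup_of_module[OF J]]
  let ?M = "{x. \<exists>d\<in>A. d \<noteq> 0 \<and> const_fract d * x \<in> J}"
  have scale: "const_fract a * x \<in> J" if "a \<in> A" "x \<in> J" for a x
    using module_scale[OF J that(2) const_fract_mem_IntR[OF domain_with_qfD(1)[OF A] that(1)]]
    by (simp add: mult.commute)
  have "add_subgroup ?M"
  proof (rule add_subgroupI)
    show "0 \<in> ?M" using subA(2) subJ(1) by (auto intro!: bexI[of _ 1])
  next
    fix x y assume "x \<in> ?M" "y \<in> ?M"
    then obtain d e where de: "d \<in> A" "d \<noteq> 0" "const_fract d * x \<in> J" "e \<in> A" "e \<noteq> 0" "const_fract e * y \<in> J"
      by blast
    have "const_fract e * (const_fract d * x) + const_fract d * (const_fract e * y) \<in> J"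
      by (rule subJ(2)[OF scale[OF de(4,3)] scale[OF de(1,6)]])
    then have "const_fract (d * e) * (x + y) \<in> J"
      by (simp add: const.hom_mult algebra_simps)
    then show "x + y \<in> ?M" using de subA(4) by (auto intro!: bexI[of _ "d * e"])
  next
    fix x assume "x \<in> ?M"
    then show "- x \<in> ?M" using subJ(3) by auto
  qed
  then have "J \<star> IntR UNIV \<subseteq> ?M"
  proof (rule prod_span_least)
    fix j b assume j: "j \<in> J" and "b \<in> IntR (UNIV :: 'k set)"
    then obtain p where p: "b = poly_fract p" by (auto simp: IntR_UNIV)
    obtain d where d: "d \<in> A" "d \<noteq> 0" "Polynomial.smult d p \<in> IntPoly A"
      using IntPoly_denominator[OF A] by blast
    have "j * poly_fract (Polynomial.smult d p) \<in> J"
      using d(3) by (intro module_scale[OF J] j) (simp add: poly_fract_mem_IntR)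
    then have "const_fract d * (j * b) \<in> J" by (simp add: p poly_fract_simps mult_ac)
    then show "j * b \<in> ?M" using d by blast
  qed
  then have "1 \<in> ?M" using one by (rule subsetD)
  then show ?thesis by simp
qed

text \<open>A Picard class of \<^term>\<open>IntR A\<close> is represented by an ideal \<^term>\<open>J\<close> that becomes trivial over
  the polynomial ring \<^term>\<open>IntR UNIV\<close>; such an ideal and its inverse \<^term>\<open>J'\<close> contain a common nonzero constant.\<close>

definition normal_pair :: "'k::field set \<Rightarrow> 'k \<Rightarrow> 'k poly fract set \<Rightarrow> 'k poly fract set \<Rightarrow> bool" where
  "normal_pair A d J J' \<longleftrightarrow> J \<star> IntR A = J \<and> J' \<star> IntR A = J' \<and> J \<star> J' = IntR A \<and>
     d \<in> A \<and> d \<noteq> 0 \<and> const_fract d \<in> J \<and> const_fract d \<in> J'"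

text \<open>The scalar is the inverse of a generator \<open>g\<close> of \<open>I K[X]\<close>. The
  scaled ideal is trivial over \<open>K[X]\<close>, and so is its inverse; each then contains a
  nonzero constant, and the product of the two constants lies in both.\<close>

lemma exists_normal_pair:
  assumes A: "domain_with_qf A" and I: "invertible_frac_ideal (IntR A) I"
  shows "\<exists>x J' d. x \<noteq> 0 \<and> normal_pair A d ({x} \<star> I) J'"
proof -
  note R = domain_IntR[OF A] and subA = subring_ofD[OF domain_with_qfD(1)[OF A]]
  obtain I' where I': "I \<star> IntR A = I" "I' \<star> IntR A = I'" "I \<star> I' = IntR A"
    by (rule invertibleE[OF R I])
  have "invertible_frac_ideal (IntR UNIV) (I \<star> IntR UNIV)"
    using unital_hom.invertible_extension[OF unital_hom_id R domain_IntR[OF domain_UNIV] _ I]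
    by (simp add: IntR_subset_UNIV)
  then obtain g where g: "g \<noteq> 0" "I \<star> IntR UNIV = {g} \<star> IntR UNIV"
    using invertible_KX_principal by blast
  define J where "J = {inverse g} \<star> I"
  define J' where "J' = {g} \<star> I'"
  note KX = prod_span_IntR_KX[OF domain_with_qfD(1)[OF A]]
  have J: "J \<star> IntR A = J" "J' \<star> IntR A = J'"
    by (simp_all add: J_def J'_def prod_span_assoc I')
  have "J \<star> J' = {inverse g} \<star> ({g} \<star> (I \<star> I'))"
    unfolding J_def J'_def by (simp only: prod_span_ac)
  also have "\<dots> = IntR A"
    using g(1) I' by (simp add: prod_span_singleton_cancel subring_ofD[OF domain_with_qfD(1)[OF R]])
  finally have JJ': "J \<star> J' = IntR A" .
  have JKX: "J \<star> IntR UNIV = IntR UNIV"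
    using g by (simp add: J_def prod_span_assoc prod_span_singleton_cancel subring_ofD[OF subring_KX])
  have "J' \<star> IntR UNIV = J' \<star> (J \<star> IntR UNIV)" by (simp only: JKX)
  also have "\<dots> = (J \<star> J') \<star> IntR UNIV" by (simp only: prod_span_ac)
  also have "\<dots> = IntR UNIV" unfolding JJ' by (rule KX)
  finally have "1 \<in> J' \<star> IntR UNIV" "1 \<in> J \<star> IntR UNIV"
    using JKX subring_ofD(2)[OF subring_KX] by auto
  then obtain d e where de: "d \<in> A" "d \<noteq> 0" "const_fract d \<in> J" "e \<in> A" "e \<noteq> 0" "const_fract e \<in> J'"
    using constant_in_ideal[OF A] J by meson
  have "const_fract d * const_fract e \<in> J" "const_fract e * const_fract d \<in> J'"
    using de const_fract_mem_IntR[OF domain_with_qfD(1)[OF A]]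
    by (auto intro: module_scale[OF J(1)] module_scale[OF J(2)])
  then have "normal_pair A (d * e) J J'"
    using J JJ' de subA(4) by (simp add: normal_pair_def const.hom_mult mult.commute)
  then show ?thesis using g(1) unfolding J_def by (intro exI[of _ "inverse g"]) auto
qed

section \<open>The extension map from \<open>Pic(A)\<close> to \<open>Pic(Int(A))\<close>\<close>

lemma iota_pic_class:
  assumes A: "domain_with_qf A" and I: "invertible_frac_ideal A I"
  shows "iota A (pic_class A I) = pic_class (IntR A) (const_fract ` I \<star> IntR A)"
proof -
  note R = domain_IntR[OF A] and sub = const_fract_image_subset[OF domain_with_qfD(1)[OF A]]
  have "{1} \<star> I \<in> pic_class A I"
    unfolding pic_class_eq[OF assms] by (rule imageI) simp
  \<comment> \<open>The arbitrary representative chosen by \<open>iota\<close> has the form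
    \<open>{x} \<star> I\<close>. Its factor extends to the principal factor
    \<open>const_fract x\<close>, so the choice does not affect the class.\<close>
  then have "(SOME I'. I' \<in> pic_class A I) \<in> pic_class A I" by (rule someI)
  then obtain x where x: "x \<noteq> 0" "(SOME I'. I' \<in> pic_class A I) = {x} \<star> I"
    unfolding pic_class_eq[OF assms] by blast
  have "iota A (pic_class A I) = pic_class (IntR A) (const_fract ` (SOME I'. I' \<in> pic_class A I) \<star> IntR A)"
    by (simp add: iota_def pic_class_def[of "IntR A"] principal_ideals_def)
  also have "\<dots> = pic_class (IntR A) ({const_fract x} \<star> (const_fract ` I \<star> IntR A))"
    by (simp only: x(2) const.image_scale prod_span_assoc)
  also have "\<dots> = pic_class (IntR A) (const_fract ` I \<star> IntR A)"
    using x(1) by (intro pic_class_scale R const.invertible_extension[OF A R sub I])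
      (simp add: const.hom_eq_0_iff)
  finally show ?thesis .
qed

lemma iota_hom:
  assumes A: "domain_with_qf A" shows "iota A \<in> hom (Pic A) (Pic (IntR A))"
proof (rule homI)
  note R = domain_IntR[OF A] and sub = const_fract_image_subset[OF domain_with_qfD(1)[OF A]]
  note ext = const.invertible_extension[OF A R sub]
  fix C assume "C \<in> carrier (Pic A)"
  then obtain I where I: "C = pic_class A I" "invertible_frac_ideal A I" by (auto simp: carrier_Pic)
  then show "iota A C \<in> carrier (Pic (IntR A))"
    using ext by (auto simp: iota_pic_class[OF A] carrier_Pic)
  fix C' assume "C' \<in> carrier (Pic A)"
  then obtain I' where I': "C' = pic_class A I'" "invertible_frac_ideal A I'" by (auto simp: carrier_Pic)
  show "iota A (C \<otimes>\<^bsub>Pic A\<^esub> C') = iota A C \<otimes>\<^bsub>Pic (IntR A)\<^esub> iota A C'"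
    using I I' ext const.extension_mult[OF domain_with_qfD(1)[OF R]]
    by (simp add: iota_pic_class[OF A] invertible_prod_span[OF A] pic_class_mult[OF R]
        flip: pic_class_mult[OF A])
qed

lemma invertible_nonzero:
  assumes "domain_with_qf A" "invertible_frac_ideal A I"
  shows "\<exists>c\<in>I. c \<noteq> 0"
  using assms(2) by (auto simp: invertible_frac_ideal_def frac_ideal_def submodule_of_def)

text \<open>Two extensions in the same class differ by a factor \<open>x\<close> from
  \<open>K(X)\<close>. Over \<open>K[X]\<close> both become trivial, which makes \<open>x\<close> a
  constant \<open>u\<close>; the equation of extensions then contracts to
  \<open>I' = {u} \<star> I\<close> in \<open>A\<close>.\<close>

lemma iota_inj:
  assumes A: "domain_with_qf A" shows "inj_on (iota A) (carrier (Pic A))"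
proof (rule inj_onI)
  note R = domain_IntR[OF A] and sub = const_fract_image_subset[OF domain_with_qfD(1)[OF A]]
  note ext = const.invertible_extension[OF A R sub]
  note KX = prod_span_IntR_KX[OF domain_with_qfD(1)[OF A]]
  fix C C' assume "C \<in> carrier (Pic A)" "C' \<in> carrier (Pic A)" and eq: "iota A C = iota A C'"
  then obtain I I' where I: "C = pic_class A I" "invertible_frac_ideal A I"
    and I': "C' = pic_class A I'" "invertible_frac_ideal A I'" by (auto simp: carrier_Pic)
  obtain x where x: "x \<noteq> 0" "const_fract ` I' \<star> IntR A = {x} \<star> (const_fract ` I \<star> IntR A)"
    using eq I I' ext by (auto simp: iota_pic_class[OF A] pic_class_eq_iff[OF R])
  obtain c c' where c: "c \<in> I" "c \<noteq> 0" and c': "c' \<in> I'" "c' \<noteq> 0"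
    using invertible_nonzero A I I' by metis
  have "IntR UNIV = const_fract ` I' \<star> IntR A \<star> IntR UNIV"
    by (simp add: prod_span_assoc KX const_extension_KX[OF c'])
  also have "\<dots> = {x} \<star> IntR UNIV"
    unfolding x(2) by (simp add: prod_span_assoc KX const_extension_KX[OF c])
  finally obtain u where u: "u \<noteq> 0" "x = const_fract u" using scale_KX_constant[of x] by auto
  have "I' = {u} \<star> I"
  proof (rule extension_inject)
    show "const_fract ` I' \<star> IntR A = const_fract ` ({u} \<star> I) \<star> IntR A"
      by (simp add: x(2) u(2) const.image_scale prod_span_assoc)
  qed (simp_all add: prod_span_assoc invertible_module[OF A] I I' domain_with_qfD(1)[OF A])
  then show "C = C'" using I I' u(1) pic_class_scale[OF A] by simp
qed

section \<open>Approximation and gluing in Jaffard families\<close>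

locale jaffard_family =
  fixes D :: "'k::field set" and \<Theta> :: "'k set set"
  assumes D: "domain_with_qf D" and jaffard: "jaffard D \<Theta>"
begin

lemma subring_D: "subring_of D"
  by (rule domain_with_qfD(1)[OF D])

lemma flat_overring: "T \<in> \<Theta> \<Longrightarrow> flat_overring D T"
  using D jaffard by unfold_locales (auto simp: jaffard_def pre_jaffard_def)

lemma complete:
  assumes "ideal_of D I" shows "I = (\<Inter>T\<in>\<Theta>. I \<star> T)"
proof -
  have "\<forall>I. ideal_of D I \<longrightarrow> I = (\<Inter>T\<in>\<Theta>. I \<star> T)"
    using jaffard unfolding jaffard_def pre_jaffard_def by (elim conjE)
  from this[rule_format, OF assms] show ?thesis .
qed

lemma independent:
  assumes "T \<in> \<Theta>" "T' \<in> \<Theta>" "T \<noteq> T'" shows "T \<star> T' = UNIV"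
proof -
  have "\<forall>T\<in>\<Theta>. \<forall>T'\<in>\<Theta>. T \<noteq> T' \<longrightarrow> T \<star> T' = UNIV"
    using jaffard unfolding jaffard_def pre_jaffard_def by (elim conjE)
  then show ?thesis using assms by blast
qed

lemma nonempty: "\<Theta> \<noteq> {}"
proof
  assume "\<Theta> = {}"
  have "ideal_of D {0}" using subring_ofD(1)[OF subring_D] by (auto simp: ideal_of_def submodule_of_def)
  then have "{0} = (\<Inter>T\<in>\<Theta>. {0} \<star> T)" by (rule complete)
  then have "1 \<in> {0 :: 'k}" using \<open>\<Theta> = {}\<close> by simp
  then show False by simp
qed

text \<open>Completeness in the form of a local test: whether an ideal of \<open>D\<close> is the
  unit ideal can be checked over each member of \<open>\<Theta>\<close>.\<close>

lemma one_mem_ideal: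
  assumes "I \<star> D = I" "I \<subseteq> D" "\<And>T. T \<in> \<Theta> \<Longrightarrow> 1 \<in> I \<star> T"
  shows "1 \<in> I"
proof -
  have "ideal_of D I" using assms(1,2) by (simp add: ideal_of_def submodule_of_iff[OF subring_D])
  then have "I = (\<Inter>T\<in>\<Theta>. I \<star> T)" by (rule complete)
  then show ?thesis using assms(3) by blast
qed

text \<open>Independence gives \<open>T T' = K\<close>, so the extension of \<open>dT\<close> to
  \<open>T'\<close> contains \<open>1\<close>; flatness of \<open>T'\<close> carries this over to
  the contraction of \<open>dT\<close> to \<open>D\<close>.\<close>

lemma one_mem_scaled_contraction:
  assumes "T \<in> \<Theta>" "T' \<in> \<Theta>" "T \<noteq> T'" "d \<noteq> 0"
  shows "1 \<in> (D \<inter> ({d} \<star> T)) \<star> T'"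
proof -
  interpret T: flat_overring D T using assms(1) by (rule flat_overring)
  interpret T': flat_overring D T' using assms(2) by (rule flat_overring)
  have "T \<star> T' = UNIV" by (rule independent[OF assms(1-3)])
  then have "d * inverse d \<in> {d} \<star> T \<star> T'"
    unfolding prod_span_assoc by (intro prod_span_mem) auto
  then show ?thesis
    using assms(4) prod_span_overring[OF T.subring_T T.subring_D T.D_sub_T]
    by (intro T'.one_mem_contraction) (simp_all add: prod_span_assoc)
qed

lemma module_inter: "A \<star> D = A \<Longrightarrow> B \<star> D = B \<Longrightarrow> (A \<inter> B) \<star> D = A \<inter> B"
  by (intro prod_span_idI subring_D add_subgroup_inter)
    (auto intro: module_scale add_subgroup_of_module[where R = D])

lemma module_scaled: "T \<in> \<Theta> \<Longrightarrow> {d} \<star> T \<star> D = {d} \<star> T"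
  using flat_overring[of T]
  by (simp add: prod_span_assoc prod_span_overring flat_overring.subring_T flat_overring.subring_D
      flat_overring.D_sub_T)

lemma module_D: "D \<star> D = D"
  by (rule prod_span_subring[OF subring_D])

text \<open>An intersection of two ideals contains their product, so the property of extending to
  the unit ideal of \<open>T\<close> survives finite intersections. The module equation is part of
  the induction because the product argument uses it.\<close>

lemma one_mem_finite_contraction:
  assumes "T \<in> \<Theta>" "d \<noteq> 0" "finite S" "S \<subseteq> \<Theta> - {T}"
  shows "(D \<inter> (\<Inter>T'\<in>S. {d} \<star> T')) \<star> D = D \<inter> (\<Inter>T'\<in>S. {d} \<star> T') \<and> 1 \<in> (D \<inter> (\<Inter>T'\<in>S. {d} \<star> T')) \<star> T"
  using assms(3,4)
proof (induction S rule: finite_induct)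
  case empty
  have "1 * 1 \<in> D \<star> T"
    using subring_ofD(2) subring_D flat_overring.subring_T[OF flat_overring[OF assms(1)]]
    by (intro prod_span_mem) auto
  then show ?case by (simp add: module_D)
next
  case (insert T' S)
  interpret T: flat_overring D T using assms(1) by (rule flat_overring)
  let ?J = "D \<inter> (\<Inter>T'\<in>S. {d} \<star> T')" and ?I = "D \<inter> ({d} \<star> T')"
  have J: "?J \<star> D = ?J" "1 \<in> ?J \<star> T" using insert by auto
  have I: "?I \<star> D = ?I" "1 \<in> ?I \<star> T"
    using insert.prems assms(1,2) one_mem_scaled_contraction[of T' T d]
    by (auto simp: module_inter module_D module_scaled)
  have eq: "D \<inter> (\<Inter>T'\<in>insert T' S. {d} \<star> T') = ?I \<inter> ?J" by auto
  have "?I \<star> ?J \<subseteq> ?I \<inter> ?J"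
  proof (rule prod_span_least)
    show "add_subgroup (?I \<inter> ?J)"
      by (rule add_subgroup_inter[OF add_subgroup_of_module[OF I(1)] add_subgroup_of_module[OF J(1)]])
    fix a b assume ab: "a \<in> ?I" "b \<in> ?J"
    have "a * b \<in> ?I" using ab by (intro module_scale[OF I(1)]) auto
    moreover have "b * a \<in> ?J" using ab by (intro module_scale[OF J(1)]) auto
    ultimately show "a * b \<in> ?I \<inter> ?J" by (simp add: mult.commute)
  qed
  then have "1 \<in> (?I \<inter> ?J) \<star> T" by (rule T.one_mem_ideal_mult[OF I(2) J(2)])
  then show ?case unfolding eq using module_inter[OF I(1) J(1)] by blast
qed

text \<open>By independence the two contractions below are comaximal after extension to each member of
  \<^term>\<open>\<Theta>\<close>; completeness makes them comaximal in \<^term>\<open>D\<close>.\<close>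

lemma approximation:
  assumes T: "T \<in> \<Theta>" and d: "d \<in> D" "d \<noteq> 0"
  shows "\<exists>v\<in>D. (1 - v) / d \<in> T \<and> (\<forall>T'\<in>\<Theta>. T' \<noteq> T \<longrightarrow> v / d \<in> T')"
proof -
  interpret T: flat_overring D T using T by (rule flat_overring)
  \<comment> \<open>Away from \<open>T\<close> and \<open>S\<close> the element \<open>d\<close> is
    a unit, so any \<open>v \<in> D\<close> satisfies \<open>v / d \<in> T'\<close>. Local
    finiteness leaves finitely many conditions, which \<open>J\<close> collects.\<close>
  define S where "S = {T' \<in> \<Theta>. \<not> is_unit_in T' d} - {T}"
  define J where "J = D \<inter> (\<Inter>T'\<in>S. {d} \<star> T')"
  define I where "I = D \<inter> ({d} \<star> T)"
  have "finite S" using jaffard d by (auto simp: S_def jaffard_def)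
  then have J: "J \<star> D = J" "1 \<in> J \<star> T"
    using one_mem_finite_contraction[of T d S] T d(2) by (auto simp: S_def J_def)
  have I: "I \<star> D = I" by (simp add: I_def module_inter module_D module_scaled T)
  note subI = add_subgroupD[OF add_subgroup_of_module[OF I]]
    and subJ = add_subgroupD[OF add_subgroup_of_module[OF J(1)]]
  let ?K = "{a + b | a b. a \<in> I \<and> b \<in> J}"
  have IK: "I \<subseteq> ?K" and JK: "J \<subseteq> ?K" using subI(1) subJ(1) by force+
  have "1 \<in> ?K"
  proof (rule one_mem_ideal)
    have "add_subgroup ?K"
    proof (rule add_subgroupI)
      show "0 \<in> ?K" using IK subI(1) by blast
    next
      fix x y assume "x \<in> ?K" "y \<in> ?K"
      then obtain a b a' b' where "x = a + b" "y = a' + b'" "a \<in> I" "b \<in> J" "a' \<in> I" "b' \<in> J" by blast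
      then have "x + y = (a + a') + (b + b')" "a + a' \<in> I" "b + b' \<in> J" using subI(2) subJ(2) by auto
      then show "x + y \<in> ?K" by blast
    next
      fix x assume "x \<in> ?K"
      then obtain a b where "x = a + b" "a \<in> I" "b \<in> J" by blast
      then have "- x = - a + - b" "- a \<in> I" "- b \<in> J" using subI(3) subJ(3) by auto
      then show "- x \<in> ?K" by blast
    qed
    then show "?K \<star> D = ?K"
    proof (rule prod_span_idI[OF subring_D])
      fix x r assume "x \<in> ?K" "r \<in> D"
      then obtain a b where "x = a + b" "a \<in> I" "b \<in> J" by blast
      then have "x * r = a * r + b * r" "a * r \<in> I" "b * r \<in> J"
        using module_scale[OF I] module_scale[OF J(1)] \<open>r \<in> D\<close> by (auto simp: distrib_right)
      then show "x * r \<in> ?K" by blast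
    qed
    show "?K \<subseteq> D" using subring_ofD(3)[OF subring_D] by (auto simp: I_def J_def)
    fix T' assume T': "T' \<in> \<Theta>"
    \<comment> \<open>Over \<open>T\<close> the summand \<open>J\<close> already extends to the unit
      ideal; over every other member the summand \<open>I\<close> does.\<close>
    show "1 \<in> ?K \<star> T'"
    proof (cases "T' = T")
      case True
      then show ?thesis using J(2) prod_span_mono[OF JK order_refl, of T] by blast
    next
      case False
      then have "1 \<in> I \<star> T'"
        unfolding I_def using T T' d(2) by (intro one_mem_scaled_contraction) auto
      then show ?thesis using prod_span_mono[OF IK order_refl, of T'] by blast
    qed
  qed
  then obtain u v where uv: "1 = u + v" "u \<in> I" "v \<in> J" by blast
  have div: "x / d \<in> T'" if "x \<in> {d} \<star> T'" "T' \<in> \<Theta>" for x T'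
    using that d(2) singleton_prod_span[OF subring_ofD(7)[OF flat_overring.subring_T[OF flat_overring[OF that(2)]]]]
    by auto
  show ?thesis
  proof (intro bexI conjI ballI impI)
    show "v \<in> D" using uv(3) by (simp add: J_def)
    have "1 - v = u" by (simp add: uv(1))
    then show "(1 - v) / d \<in> T" using uv(2) div[of u T] T by (simp add: I_def)
    fix T' assume T': "T' \<in> \<Theta>" "T' \<noteq> T"
    show "v / d \<in> T'"
    proof (cases "T' \<in> S")
      case True
      then show ?thesis using uv(3) div[of v T'] T' by (auto simp: J_def)
    next
      case False
      then obtain y where y: "y \<in> T'" "d * y = 1" using T' by (auto simp: S_def is_unit_in_def)
      have "v / d = v * y" using y(2) d(2) by (simp add: field_simps)
      then show ?thesis
        using y(1) \<open>v \<in> D\<close> flat_overring.D_sub_T[OF flat_overring[OF T'(1)]]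
          subring_ofD(4)[OF flat_overring.subring_T[OF flat_overring[OF T'(1)]]] by auto
    qed
  qed
qed

end

section \<open>Local-global principle and gluing of modules\<close>

locale jaffard_family_hom = jaffard_family D \<Theta> + unital_hom h
  for D :: "'k::field set" and \<Theta> :: "'k set set" and h :: "'k \<Rightarrow> 'l::field"
begin

text \<open>By \<open>one_mem_colon\<close> the conductor of \<open>x\<close> in \<open>M\<close>
  extends to the unit ideal of each member of \<open>\<Theta>\<close>, so by completeness it
  contains \<open>1\<close>.\<close>

lemma local_global:
  assumes M: "M \<star> h ` D = M" and x: "\<And>T. T \<in> \<Theta> \<Longrightarrow> x \<in> M \<star> h ` T"
  shows "x \<in> M"
proof -
  note subM = add_subgroupD[OF add_subgroup_of_module[OF M]]
  have "1 \<in> {d \<in> D. h d * x \<in> M}"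
  proof (rule one_mem_ideal)
    show "{d \<in> D. h d * x \<in> M} \<star> D = {d \<in> D. h d * x \<in> M}"
    proof (rule prod_span_idI[OF subring_D])
      show "add_subgroup {d \<in> D. h d * x \<in> M}"
        using subM subring_ofD[OF subring_D]
        by (intro add_subgroupI) (simp_all add: hom_zero hom_add hom_minus distrib_right)
      fix d r assume d: "d \<in> {d \<in> D. h d * x \<in> M}" "r \<in> D"
      then have "(h d * x) * h r \<in> M" by (auto intro: module_scale[OF M, of "h d * x"])
      then show "d * r \<in> {d \<in> D. h d * x \<in> M}"
        using d subring_ofD(4)[OF subring_D] by (auto simp: hom_mult mult_ac)
    qed
    fix T assume mem: "T \<in> \<Theta>"
    interpret flat_overring_hom D T h
      using flat_overring[OF mem] unital_hom_axioms by (rule flat_overring_hom.intro)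
    show "1 \<in> {d \<in> D. h d * x \<in> M} \<star> T" by (rule one_mem_colon[OF M x[OF mem]])
  qed auto
  then show ?thesis by (simp add: hom_one)
qed

text \<open>An element of one \<^term>\<open>N T\<close> is split by the approximation lemma into a part that lies in
  every member of the family and a multiple of such a part by an element of \<^term>\<open>T\<close>.\<close>

lemma glue_module:
  assumes S: "\<And>T. T \<in> \<Theta> \<Longrightarrow> subring_of (S T)" "\<And>T. T \<in> \<Theta> \<Longrightarrow> h ` T \<subseteq> S T"
    and N: "\<And>T. T \<in> \<Theta> \<Longrightarrow> N T \<star> S T = N T" "\<And>T. T \<in> \<Theta> \<Longrightarrow> h d \<in> N T" "d \<in> D" "d \<noteq> 0"
    and N0: "\<And>T x. T \<in> \<Theta> \<Longrightarrow> x \<in> N T \<Longrightarrow> \<exists>e\<in>D. e \<noteq> 0 \<and> (\<forall>T'\<in>\<Theta>. h e * x \<in> S T')"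
    and T: "T \<in> \<Theta>"
  shows "(\<Inter>T\<in>\<Theta>. N T) \<star> h ` T = N T"
proof
  let ?M = "\<Inter>T\<in>\<Theta>. N T"
  show "?M \<star> h ` T \<subseteq> N T"
    using prod_span_mono[of ?M "N T" "h ` T" "S T"] S(2) N(1) T by blast
  show "N T \<subseteq> ?M \<star> h ` T"
  proof
    fix x assume x: "x \<in> N T"
    obtain e where e: "e \<in> D" "e \<noteq> 0" "\<And>T'. T' \<in> \<Theta> \<Longrightarrow> h e * x \<in> S T'" using N0[OF T x] by blast
    \<comment> \<open>\<open>e\<close> carries \<open>x\<close> into all the rings
      \<open>S T'\<close>, and \<open>h d\<close> lies in all the modules \<open>N T'\<close>, so
      \<open>y\<close> lies in every \<open>N T'\<close>. With modulus \<open>d * e\<close>, both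
      \<open>h v * x\<close> and \<open>h (1 - v) * x\<close> become multiples of \<open>y\<close>
      by \<open>h v\<close> or \<open>h (1 - v)\<close> divided by \<open>h (d * e)\<close>.\<close>
    define y where "y = h d * (h e * x)"
    have y: "y \<in> N T'" if "T' \<in> \<Theta>" for T'
      unfolding y_def using N(2) e(3) that by (intro module_scale[OF N(1)]) auto
    have de: "d * e \<in> D" "d * e \<noteq> 0" using N(3,4) e subring_ofD(4)[OF subring_D] by auto
    obtain v where v: "v \<in> D" "(1 - v) / (d * e) \<in> T"
      "\<And>T'. T' \<in> \<Theta> \<Longrightarrow> T' \<noteq> T \<Longrightarrow> v / (d * e) \<in> T'"
      using approximation[OF T de] by blast
    have scale: "h a * x = y * h (a / (d * e))" for a
    proof -
      have "h a = h (d * e * (a / (d * e)))" using de(2) by simp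
      then show ?thesis unfolding y_def hom_mult by (simp add: mult_ac)
    qed
    have "h v * x \<in> N T'" if T': "T' \<in> \<Theta>" for T'
    proof (cases "T' = T")
      case True
      have "x * h v \<in> N T"
        using x v(1) S(2)[OF T] flat_overring.D_sub_T[OF flat_overring[OF T]]
        by (intro module_scale[OF N(1)[OF T]]) auto
      then show ?thesis using True by (simp add: mult.commute)
    next
      case False
      then show ?thesis
        unfolding scale using v(3) S(2) T' y by (intro module_scale[OF N(1)]) auto
    qed
    then have "h v * x * h 1 \<in> ?M \<star> h ` T"
      using subring_ofD(2)[OF flat_overring.subring_T[OF flat_overring[OF T]]]
      by (intro prod_span_mem) auto
    moreover have "h (1 - v) * x \<in> ?M \<star> h ` T"
      unfolding scale using y v(2) by (intro prod_span_mem) auto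
    ultimately have "h v * x * h 1 + h (1 - v) * x \<in> ?M \<star> h ` T" by (rule prod_span_closed(2))
    then show "x \<in> ?M \<star> h ` T" by (simp add: hom_diff hom_one left_diff_distrib)
  qed
qed

text \<open>The two intersections extend back to \<open>N T\<close> and \<open>N' T\<close>, so
  their product extends to \<open>S T\<close> at every member; \<open>local_global\<close> turns
  this into equality with \<open>R\<close>. The bound \<open>d\<close> has to lie on both sides
  because each of the two families is glued separately.\<close>

lemma glue_inverse:
  assumes rings: "\<forall>T\<in>\<Theta>. subring_of (S T) \<and> h ` T \<subseteq> S T"
    and modules: "\<forall>T\<in>\<Theta>. N T \<star> S T = N T \<and> N' T \<star> S T = N' T \<and> N T \<star> N' T = S T"
    and "d \<in> D" "d \<noteq> 0" and bound: "\<forall>T\<in>\<Theta>. h d \<in> N T \<and> h d \<in> N' T"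
    and denominators: "\<forall>T\<in>\<Theta>. \<forall>x\<in>S T. \<exists>e\<in>D. e \<noteq> 0 \<and> (\<forall>T'\<in>\<Theta>. h e * x \<in> S T')"
    and R: "R = (\<Inter>T\<in>\<Theta>. S T)" and M: "M = (\<Inter>T\<in>\<Theta>. N T)" and M': "M' = (\<Inter>T\<in>\<Theta>. N' T)"
  shows "M \<star> R = M" "M' \<star> R = M'" "M \<star> M' = R" "T \<in> \<Theta> \<Longrightarrow> M \<star> h ` T = N T"
proof -
  have S: "\<And>T. T \<in> \<Theta> \<Longrightarrow> subring_of (S T)" "\<And>T. T \<in> \<Theta> \<Longrightarrow> h ` T \<subseteq> S T"
    using rings by blast+
  have N: "\<And>T. T \<in> \<Theta> \<Longrightarrow> N T \<star> S T = N T" "\<And>T. T \<in> \<Theta> \<Longrightarrow> N' T \<star> S T = N' T"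
    "\<And>T. T \<in> \<Theta> \<Longrightarrow> N T \<star> N' T = S T"
    using modules by (elim ballE conjE; blast)+
  have d: "d \<in> D" "d \<noteq> 0" "\<And>T. T \<in> \<Theta> \<Longrightarrow> h d \<in> N T" "\<And>T. T \<in> \<Theta> \<Longrightarrow> h d \<in> N' T"
    using assms(3,4) bound by blast+
  have S0: "\<exists>e\<in>D. e \<noteq> 0 \<and> (\<forall>T'\<in>\<Theta>. h e * x \<in> S T')" if "T \<in> \<Theta>" "x \<in> S T" for T x
    using denominators that by blast
  \<comment> \<open>As \<open>h d\<close> lies in the inverse module, \<open>x * h d\<close> lies in
    \<open>S T\<close>, where denominators are available; \<open>d\<close> is then absorbed into the
    denominator.\<close>
  have den: "\<exists>e\<in>D. e \<noteq> 0 \<and> (\<forall>T'\<in>\<Theta>. h e * x \<in> S T')"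
    if "T \<in> \<Theta>" "x \<in> N T" "\<And>T. T \<in> \<Theta> \<Longrightarrow> h d \<in> N' T" "\<And>T. T \<in> \<Theta> \<Longrightarrow> N T \<star> N' T = S T" for N N' T x
  proof -
    have "x * h d \<in> S T" using that prod_span_mem by blast
    from S0[OF that(1) this] obtain e where "e \<in> D" "e \<noteq> 0" "\<forall>T'\<in>\<Theta>. h e * (x * h d) \<in> S T'"
      by blast
    then show ?thesis
      using d(1,2) subring_ofD(4)[OF subring_D] by (intro bexI[of _ "e * d"]) (auto simp: hom_mult mult_ac)
  qed
  have N'N: "N' T \<star> N T = S T" if "T \<in> \<Theta>" for T
    using N(3)[OF that] by (simp add: prod_span_commute)
  show MT: "M \<star> h ` T = N T" if "T \<in> \<Theta>" for T
    unfolding M by (rule glue_module[OF S N(1) d(3,1,2) _ that]) (use den[of _ _ N N'] N d in auto)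
  have M'T: "M' \<star> h ` T = N' T" if "T \<in> \<Theta>" for T
    unfolding M' by (rule glue_module[OF S N(2) d(4,1,2) _ that]) (use den[of _ _ N' N] N'N d in auto)
  have subR: "subring_of R" unfolding R subring_of_def
    using S(1) by (auto intro: subring_ofD)
  have RM: "(\<Inter>T\<in>\<Theta>. N T) \<star> R = (\<Inter>T\<in>\<Theta>. N T)" if "\<And>T. T \<in> \<Theta> \<Longrightarrow> N T \<star> S T = N T" for N
  proof (rule prod_span_idI[OF subR])
    show "add_subgroup (\<Inter>T\<in>\<Theta>. N T)"
      by (rule add_subgroup_Inter) (rule add_subgroup_of_module[OF that])
    fix x r assume xr: "x \<in> (\<Inter>T\<in>\<Theta>. N T)" "r \<in> R"
    show "x * r \<in> (\<Inter>T\<in>\<Theta>. N T)"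
    proof
      fix T assume T: "T \<in> \<Theta>"
      show "x * r \<in> N T" by (rule module_scale[OF that[OF T]]) (use xr T in \<open>auto simp: R\<close>)
    qed
  qed
  show MR: "M \<star> R = M" "M' \<star> R = M'" unfolding M M' by (rule RM, rule N, assumption)+
  have "h ` D \<subseteq> R"
    using S(2) flat_overring.D_sub_T[OF flat_overring] unfolding R by blast
  then have RD: "R \<star> h ` D = R" by (intro prod_span_overring subR subring_of_image subring_D)
  have MM'T: "M \<star> M' \<star> h ` T = S T" if T: "T \<in> \<Theta>" for T
  proof -
    have "h ` T \<star> h ` T = h ` T"
      using prod_span_subring[OF flat_overring.subring_T[OF flat_overring[OF T]]]
      by (simp flip: image_prod_span)
    then have "M \<star> M' \<star> h ` T = M \<star> M' \<star> (h ` T \<star> h ` T)" by simp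
    also have "\<dots> = (M \<star> h ` T) \<star> (M' \<star> h ` T)" by (simp only: prod_span_ac)
    finally show ?thesis using MT M'T N(3) T by simp
  qed
  show "M \<star> M' = R"
  proof
    have "M \<star> M' \<subseteq> S T" if T: "T \<in> \<Theta>" for T
    proof -
      have "1 \<in> h ` T"
        using subring_ofD(2)[OF flat_overring.subring_T[OF flat_overring[OF T]]] hom_one
        by (metis image_eqI)
      then show ?thesis using subset_prod_span_one[of "h ` T" "M \<star> M'"] MM'T[OF T] by simp
    qed
    then show "M \<star> M' \<subseteq> R" unfolding R by blast
    show "R \<subseteq> M \<star> M'"
    proof
      fix x assume "x \<in> R"
      show "x \<in> M \<star> M'"
      proof (rule local_global)
        have "M' \<star> h ` D = (M' \<star> R) \<star> h ` D" by (simp only: MR(2))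
        also have "\<dots> = M' \<star> (R \<star> h ` D)" by (rule prod_span_assoc)
        also have "\<dots> = M'" by (simp only: RD MR(2))
        finally have "M' \<star> h ` D = M'" .
        then show "M \<star> M' \<star> h ` D = M \<star> M'" by (simp add: prod_span_assoc)
        show "x \<in> M \<star> M' \<star> h ` T" if "T \<in> \<Theta>" for T
          using \<open>x \<in> R\<close> that MM'T unfolding R by blast
      qed
    qed
  qed
qed

end

sublocale jaffard_family \<subseteq> id: jaffard_family_hom D \<Theta> "\<lambda>x. x"
  by (intro jaffard_family_hom.intro jaffard_family_axioms unital_hom_id)

sublocale jaffard_family \<subseteq> const: jaffard_family_hom D \<Theta> const_fract
  by (intro jaffard_family_hom.intro jaffard_family_axioms unital_hom_const_fract)

section \<open>\<open>D\<close> and \<open>Int(D)\<close> as intersections, and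
  \<open>Int(T)\<close> as an extension of \<open>Int(D)\<close>\<close>

context jaffard_family
begin

lemma Inter_eq: "D = (\<Inter>T\<in>\<Theta>. T)"
proof
  show "D \<subseteq> (\<Inter>T\<in>\<Theta>. T)" using flat_overring.D_sub_T[OF flat_overring] by blast
  show "(\<Inter>T\<in>\<Theta>. T) \<subseteq> D"
  proof
    fix x assume x: "x \<in> (\<Inter>T\<in>\<Theta>. T)"
    show "x \<in> D"
    proof (rule id.local_global)
      fix T assume "T \<in> \<Theta>"
      then have "1 * x \<in> D \<star> T" using x subring_ofD(2)[OF subring_D] by (intro prod_span_mem) auto
      then show "x \<in> D \<star> (\<lambda>x. x) ` T" by simp
    qed (simp add: module_D)
  qed
qed

lemma IntR_subset: "T \<in> \<Theta> \<Longrightarrow> IntR D \<subseteq> IntR T"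
  using flat_overring.IntPoly_subset[OF flat_overring] by (auto simp: IntR_alt)

lemma IntR_Inter_eq: "IntR D = (\<Inter>T\<in>\<Theta>. IntR T)"
proof
  show "IntR D \<subseteq> (\<Inter>T\<in>\<Theta>. IntR T)" using IntR_subset by blast
  show "(\<Inter>T\<in>\<Theta>. IntR T) \<subseteq> IntR D"
  proof
    fix x assume x: "x \<in> (\<Inter>T\<in>\<Theta>. IntR T)"
    then obtain f where f: "x = poly_fract f" using nonempty by (auto simp: IntR_alt)
    have "f \<in> IntPoly D"
      unfolding IntPoly_def
    proof (intro CollectI ballI)
      fix a assume "a \<in> D"
      then have "poly f a \<in> T" if "T \<in> \<Theta>" for T
        using x that flat_overring.D_sub_T[OF flat_overring[OF that]]
        by (auto simp: f poly_fract_mem_IntR IntPoly_def)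
      then show "poly f a \<in> D" using Inter_eq by blast
    qed
    then show "x \<in> IntR D" by (simp add: f poly_fract_mem_IntR)
  qed
qed

text \<open>With \<open>d f \<in> Int(D)\<close>, the splitting
  \<open>f = v f + ((1 - v) / d) (d f)\<close> does it. Here \<open>v f\<close> lies in
  \<open>Int(T)\<close> because \<open>v \<in> D\<close>, and in every other \<open>Int(T')\<close>
  because \<open>v f = (v / d) (d f)\<close>; hence it lies in \<open>Int(D)\<close>. The other
  summand has its coefficient in \<open>T\<close>.\<close>

lemma IntR_extension:
  assumes T: "T \<in> \<Theta>" shows "IntR D \<star> const_fract ` T = IntR T"
proof
  interpret flat_overring D T by (rule flat_overring[OF T])
  note subT = IntPoly_closed[OF subring_T]
  have "IntR D \<star> const_fract ` T \<subseteq> IntR T \<star> IntR T"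
    by (intro prod_span_mono IntR_subset assms const_fract_image_subset subring_T)
  then show "IntR D \<star> const_fract ` T \<subseteq> IntR T"
    by (simp add: prod_span_subring[OF subring_IntR[OF subring_T]])
  show "IntR T \<subseteq> IntR D \<star> const_fract ` T"
  proof
    fix x assume "x \<in> IntR T"
    then obtain f where f: "x = poly_fract f" "f \<in> IntPoly T" by (auto simp: IntR_alt)
    obtain d where d: "d \<in> D" "d \<noteq> 0" "Polynomial.smult d f \<in> IntPoly D"
      using IntPoly_denominator[OF D] by blast
    obtain v where v: "v \<in> D" "(1 - v) / d \<in> T" "\<And>T'. T' \<in> \<Theta> \<Longrightarrow> T' \<noteq> T \<Longrightarrow> v / d \<in> T'"
      using approximation[OF assms d(1,2)] by blast
    have "poly_fract (Polynomial.smult v f) \<in> IntR T'" if T': "T' \<in> \<Theta>" for T'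
    proof (cases "T' = T")
      case True
      then show ?thesis using subT(7)[of v f] v(1) D_sub_T f(2) by (auto simp: poly_fract_mem_IntR)
    next
      case False
      interpret T': flat_overring D T' by (rule flat_overring[OF T'])
      have "Polynomial.smult (v / d) (Polynomial.smult d f) \<in> IntPoly T'"
        by (rule IntPoly_closed(7)[OF T'.subring_T v(3)[OF that False]])
          (use d(3) T'.IntPoly_subset in blast)
      then show ?thesis using d(2) by (simp add: poly_fract_mem_IntR)
    qed
    then have "poly_fract (Polynomial.smult v f) \<in> IntR D" unfolding IntR_Inter_eq by blast
    then have "poly_fract (Polynomial.smult v f) * const_fract 1 \<in> IntR D \<star> const_fract ` T"
      using subring_ofD(2)[OF subring_T] by (intro prod_span_mem) auto
    moreover have "poly_fract (Polynomial.smult d f) * const_fract ((1 - v) / d) \<in> IntR D \<star> const_fract ` T"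
      using d(3) v(2) by (intro prod_span_mem) (auto simp: poly_fract_mem_IntR)
    ultimately have "poly_fract (Polynomial.smult v f) * const_fract 1
        + poly_fract (Polynomial.smult d f) * const_fract ((1 - v) / d) \<in> IntR D \<star> const_fract ` T"
      by (rule prod_span_closed(2))
    also have "poly_fract (Polynomial.smult v f) * const_fract 1
        + poly_fract (Polynomial.smult d f) * const_fract ((1 - v) / d)
      = poly_fract (Polynomial.smult v f + Polynomial.smult ((1 - v) / d) (Polynomial.smult d f))"
      unfolding poly_fract_simps(3) poly_fract_simps(8)[of "(1 - v) / d"] const.hom_one by (simp add: mult.commute)
    also have "Polynomial.smult v f + Polynomial.smult ((1 - v) / d) (Polynomial.smult d f) = f"
      using d(2) by (simp flip: smult_add_left)
    finally show "x \<in> IntR D \<star> const_fract ` T" by (simp add: f)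
  qed
qed

end

section \<open>The exact sequence\<close>

definition picint_class :: "'k::field set \<Rightarrow> 'k poly fract set \<Rightarrow> 'k poly fract set set set" where
  "picint_class A M = (iota A ` carrier (Pic A)) #>\<^bsub>Pic (IntR A)\<^esub> pic_class (IntR A) M"

lemma subgroup_iota_image:
  assumes A: "domain_with_qf A"
  shows "subgroup (iota A ` carrier (Pic A)) (Pic (IntR A))"
proof -
  interpret group_hom "Pic A" "Pic (IntR A)" "iota A"
    using iota_hom[OF A] comm_group_Pic[OF A] comm_group_Pic[OF domain_IntR[OF A]]
    by (auto simp: group_hom_def group_hom_axioms_def comm_group_def)
  show ?thesis by (rule img_is_subgroup)
qed

lemma comm_group_PicInt:
  assumes "domain_with_qf A" shows "comm_group (PicInt A)"
  unfolding PicInt_def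
  by (rule comm_group.abelian_FactGroup[OF comm_group_Pic[OF domain_IntR[OF assms]] subgroup_iota_image[OF assms]])

lemma carrier_PicInt: "carrier (PicInt A) = picint_class A ` {M. invertible_frac_ideal (IntR A) M}"
  by (simp add: PicInt_def carrier_FactGroup carrier_Pic picint_class_def[abs_def] image_image)

lemma picint_class_mult:
  assumes A: "domain_with_qf A" and M: "invertible_frac_ideal (IntR A) M" "invertible_frac_ideal (IntR A) N"
  shows "picint_class A (M \<star> N) = picint_class A M \<otimes>\<^bsub>PicInt A\<^esub> picint_class A N"
proof -
  note R = domain_IntR[OF A]
  have "iota A ` carrier (Pic A) \<lhd> Pic (IntR A)"
    using subgroup_iota_image[OF A] by (simp add: comm_group.normal_iff_subgroup[OF comm_group_Pic[OF R]])
  then have "(\<lambda>a. iota A ` carrier (Pic A) #>\<^bsub>Pic (IntR A)\<^esub> a) \<in> hom (Pic (IntR A)) (PicInt A)"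
    unfolding PicInt_def by (rule normal.r_coset_hom_Mod)
  from hom_mult[OF this, of "pic_class (IntR A) M" "pic_class (IntR A) N"] show ?thesis
    using M by (simp add: picint_class_def pic_class_mult[OF R] carrier_Pic)
qed

lemma picint_class_scale:
  assumes "domain_with_qf A" "invertible_frac_ideal (IntR A) M" "x \<noteq> 0"
  shows "picint_class A ({x} \<star> M) = picint_class A M"
  using assms by (simp add: picint_class_def pic_class_scale domain_IntR)

lemma pic_class_mem_iota_image_iff:
  assumes A: "domain_with_qf A" and M: "invertible_frac_ideal (IntR A) M"
  shows "pic_class (IntR A) M \<in> iota A ` carrier (Pic A) \<longleftrightarrow>
    (\<exists>I x. invertible_frac_ideal A I \<and> x \<noteq> 0 \<and> M = {x} \<star> (const_fract ` I \<star> IntR A))"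
proof -
  note R = domain_IntR[OF A]
  note ext = const.invertible_extension[OF A R const_fract_image_subset[OF domain_with_qfD(1)[OF A]]]
  have "pic_class (IntR A) M = iota A (pic_class A I) \<longleftrightarrow> (\<exists>x. x \<noteq> 0 \<and> M = {x} \<star> (const_fract ` I \<star> IntR A))"
    if I: "invertible_frac_ideal A I" for I
    unfolding iota_pic_class[OF A I] eq_commute[of "pic_class (IntR A) M"]
    by (rule pic_class_eq_iff[OF R ext[OF I] M])
  then show ?thesis by (auto simp: carrier_Pic image_iff)
qed

text \<open>A coset is trivial exactly when its representative lies in the subgroup. Triviality
  thereby becomes an equation between ideals, up to a factor from \<open>K(X)\<close>.\<close>

lemma picint_class_eq_one_iff:
  assumes A: "domain_with_qf A" and M: "invertible_frac_ideal (IntR A) M"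
  shows "picint_class A M = \<one>\<^bsub>PicInt A\<^esub> \<longleftrightarrow>
    (\<exists>I x. invertible_frac_ideal A I \<and> x \<noteq> 0 \<and> M = {x} \<star> (const_fract ` I \<star> IntR A))"
proof -
  note R = domain_IntR[OF A]
  interpret comm_group "Pic (IntR A)" by (rule comm_group_Pic[OF R])
  have "pic_class (IntR A) M \<in> carrier (Pic (IntR A))" using M by (auto simp: carrier_Pic)
  then have "picint_class A M = \<one>\<^bsub>PicInt A\<^esub> \<longleftrightarrow> pic_class (IntR A) M \<in> iota A ` carrier (Pic A)"
    using coset_join1[OF _ _ subgroup_iota_image[OF A]] coset_join2[OF _ subgroup_iota_image[OF A]]
    unfolding picint_class_def PicInt_def one_FactGroup by blast
  then show ?thesis by (simp only: pic_class_mem_iota_image_iff[OF assms])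
qed

lemma picint_class_one:
  assumes A: "domain_with_qf A" shows "picint_class A (IntR A) = \<one>\<^bsub>PicInt A\<^esub>"
proof -
  note R = domain_IntR[OF A] and subA = domain_with_qfD(1)[OF A]
  have "IntR A = {1} \<star> (const_fract ` A \<star> IntR A)"
    by (simp add: prod_span_const_fract_IntR[OF subA] prod_span_one subring_ofD(7)[OF subring_IntR[OF subA]])
  then show ?thesis
    using invertible_unit[OF A] invertible_unit[OF R] zero_neq_one
    unfolding picint_class_eq_one_iff[OF A invertible_unit[OF R]] by metis
qed

text \<open>If \<open>d\<close> is a unit, both \<open>J\<close> and \<open>J'\<close> contain
  \<open>1\<close>. Then \<open>J\<close> lies in \<open>J \<star> J' = Int(A)\<close>, and being a
  module it also contains \<open>Int(A)\<close>.\<close>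

lemma normal_pair_unit:
  assumes A: "domain_with_qf A" and J: "normal_pair A d J J'" and "is_unit_in A d"
  shows "J = IntR A"
proof -
  note subA = domain_with_qfD(1)[OF A]
  have one: "1 \<in> J" if "J \<star> IntR A = J" "const_fract d \<in> J" for J
  proof -
    obtain y where y: "y \<in> A" "d * y = 1" using assms(3) by (auto simp: is_unit_in_def)
    have "const_fract d * const_fract y \<in> J"
      by (intro module_scale[OF that] const_fract_mem_IntR subA y)
    also have "const_fract d * const_fract y = 1"
      unfolding const.hom_mult[symmetric] y(2) by (rule const.hom_one)
    finally show ?thesis .
  qed
  have "1 \<in> J" "1 \<in> J'" using J one[of J] one[of J'] by (auto simp: normal_pair_def)
  have "J \<subseteq> J \<star> J'" using \<open>1 \<in> J'\<close> by (rule subset_prod_span_one)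
  moreover have "IntR A \<subseteq> IntR A \<star> J" using \<open>1 \<in> J\<close> by (rule subset_prod_span_one)
  ultimately show ?thesis using J by (auto simp: normal_pair_def prod_span_commute)
qed

section \<open>The localization map into the direct sum\<close>

context jaffard_family
begin

lemma domain_T: "T \<in> \<Theta> \<Longrightarrow> domain_with_qf T"
  by (rule flat_overring.domain_T[OF flat_overring])

lemma D_sub_T: "T \<in> \<Theta> \<Longrightarrow> D \<subseteq> T"
  by (rule flat_overring.D_sub_T[OF flat_overring])

lemma prod_span_IntR: "T \<in> \<Theta> \<Longrightarrow> IntR D \<star> IntR T = IntR T"
  unfolding prod_span_commute[of "IntR D"]
  by (intro prod_span_overring domain_with_qfD(1) domain_IntR domain_T D IntR_subset)

text \<open>Extension to \<open>Int(T)\<close> amounts to adjoining the constants of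
  \<open>T\<close>, which is the kind of extension that the gluing statements speak of.\<close>

lemma IntR_module_extension:
  assumes "T \<in> \<Theta>" "M \<star> IntR D = M"
  shows "M \<star> IntR T = M \<star> const_fract ` T"
  unfolding IntR_extension[OF assms(1), symmetric] prod_span_assoc[symmetric] assms(2) ..

lemma invertible_extension_T:
  assumes "T \<in> \<Theta>" "invertible_frac_ideal (IntR D) M"
  shows "invertible_frac_ideal (IntR T) (M \<star> IntR T)"
  using unital_hom.invertible_extension[OF unital_hom_id domain_IntR[OF D]
      domain_IntR[OF domain_T[OF assms(1)]] _ assms(2)] IntR_subset[OF assms(1)] by simp

text \<open>Defined on ideals rather than on classes, so that no representative has to be chosen; it
  descends to \<open>Pic\<close> by the universal property of the quotient. Restriction to
  \<open>\<Theta>\<close> gives the extensional functions of which the carrier of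
  \<open>sum_group\<close> consists.\<close>

definition localization :: "'k poly fract set \<Rightarrow> 'k set \<Rightarrow> 'k poly fract set set set" where
  "localization M = (\<lambda>T\<in>\<Theta>. picint_class T (M \<star> IntR T))"

lemma group_PicInt: "T \<in> \<Theta> \<Longrightarrow> group (PicInt T)"
  using comm_group_PicInt[OF domain_T] by (simp add: comm_group_def)

lemma carrier_sum: "carrier (sum_group \<Theta> PicInt) =
    {s \<in> \<Pi>\<^sub>E T\<in>\<Theta>. carrier (PicInt T). finite {T \<in> \<Theta>. s T \<noteq> \<one>\<^bsub>PicInt T\<^esub>}}"
  by (rule carrier_sum_group[OF group_PicInt])

lemma normal_pair_extension:
  assumes T: "T \<in> \<Theta>" and J: "normal_pair D d J J'"
  shows "normal_pair T d (J \<star> IntR T) (J' \<star> IntR T)"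
proof -
  note S = subring_IntR[OF domain_with_qfD(1)[OF domain_T[OF T]]]
  have "(J \<star> IntR T) \<star> (J' \<star> IntR T) = (J \<star> J') \<star> (IntR T \<star> IntR T)" by (simp only: prod_span_ac)
  then have "(J \<star> IntR T) \<star> (J' \<star> IntR T) = IntR T"
    using J by (simp add: normal_pair_def prod_span_subring[OF S] prod_span_IntR[OF T])
  moreover have "J \<subseteq> J \<star> IntR T" "J' \<subseteq> J' \<star> IntR T"
    using subring_ofD(2)[OF S] by (simp_all add: subset_prod_span_one)
  ultimately show ?thesis
    using J D_sub_T[OF T] unfolding normal_pair_def
    by (auto simp: prod_span_assoc prod_span_subring[OF S])
qed

lemma localization_mem_sum:
  assumes M: "invertible_frac_ideal (IntR D) M"
  shows "localization M \<in> carrier (sum_group \<Theta> PicInt)"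
proof -
  obtain x J' d where x: "x \<noteq> 0" "normal_pair D d ({x} \<star> M) J'"
    using exists_normal_pair[OF D M] by blast
  have "localization M T = \<one>\<^bsub>PicInt T\<^esub>" if T: "T \<in> \<Theta>" "is_unit_in T d" for T
  proof -
    have "{x} \<star> (M \<star> IntR T) = IntR T"
      using normal_pair_unit[OF domain_T[OF T(1)] normal_pair_extension[OF T(1) x(2)] T(2)]
      by (simp add: prod_span_assoc)
    then have "picint_class T (M \<star> IntR T) = \<one>\<^bsub>PicInt T\<^esub>"
      using picint_class_scale[OF domain_T[OF T(1)] invertible_extension_T[OF T(1) M] x(1)]
        picint_class_one[OF domain_T[OF T(1)]] by simp
    then show ?thesis using T(1) by (simp add: localization_def)
  qed
  then have sub: "{T \<in> \<Theta>. localization M T \<noteq> \<one>\<^bsub>PicInt T\<^esub>} \<subseteq> {T \<in> \<Theta>. \<not> is_unit_in T d}" by blast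
  have "finite {T \<in> \<Theta>. \<not> is_unit_in T d}"
    using jaffard x(2) by (simp add: jaffard_def normal_pair_def)
  then have fin: "finite {T \<in> \<Theta>. localization M T \<noteq> \<one>\<^bsub>PicInt T\<^esub>}" by (rule finite_subset[OF sub])
  have "localization M \<in> (\<Pi>\<^sub>E T\<in>\<Theta>. carrier (PicInt T))"
    using invertible_extension_T[OF _ M] by (auto simp: localization_def carrier_PicInt)
  with fin show ?thesis unfolding carrier_sum by blast
qed

lemma localization_hom: "localization \<in> hom (InvIdeals (IntR D)) (sum_group \<Theta> PicInt)"
proof (rule homI)
  fix M assume "M \<in> carrier (InvIdeals (IntR D))"
  then have M: "invertible_frac_ideal (IntR D) M" by (simp add: InvIdeals_def)
  then show "localization M \<in> carrier (sum_group \<Theta> PicInt)" by (rule localization_mem_sum)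
  fix N assume "N \<in> carrier (InvIdeals (IntR D))"
  then have N: "invertible_frac_ideal (IntR D) N" by (simp add: InvIdeals_def)
  have "picint_class T (M \<star> N \<star> IntR T) = picint_class T (M \<star> IntR T) \<otimes>\<^bsub>PicInt T\<^esub> picint_class T (N \<star> IntR T)"
    if T: "T \<in> \<Theta>" for T
  proof -
    have "M \<star> N \<star> IntR T = (M \<star> N) \<star> (IntR T \<star> IntR T)"
      by (simp add: prod_span_subring subring_IntR domain_with_qfD(1)[OF domain_T[OF T]])
    also have "\<dots> = (M \<star> IntR T) \<star> (N \<star> IntR T)" by (simp only: prod_span_ac)
    finally show ?thesis
      using picint_class_mult[OF domain_T[OF T] invertible_extension_T[OF T M] invertible_extension_T[OF T N]]
      by simp
  qed
  then show "localization (M \<otimes>\<^bsub>InvIdeals (IntR D)\<^esub> N) = localization M \<otimes>\<^bsub>sum_group \<Theta> PicInt\<^esub> localization N"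
    by (auto simp: localization_def InvIdeals_def intro!: restrict_ext)
qed

section \<open>Surjectivity and kernel of localization\<close>

lemma IntR_common_denominator:
  assumes "T \<in> \<Theta>" "x \<in> IntR T"
  shows "\<exists>e\<in>D. e \<noteq> 0 \<and> (\<forall>T'\<in>\<Theta>. const_fract e * x \<in> IntR T')"
proof -
  obtain f where f: "x = poly_fract f" using assms(2) by (auto simp: IntR_alt)
  obtain e where e: "e \<in> D" "e \<noteq> 0" "Polynomial.smult e f \<in> IntPoly D"
    using IntPoly_denominator[OF D] by blast
  \<comment> \<open>Clearing denominators into \<open>Int(D)\<close> serves all members at once,
    since each \<open>Int(T')\<close> contains \<open>Int(D)\<close>.\<close>
  have "const_fract e * x \<in> IntR D" using e(3) by (simp add: f poly_fract_mem_IntR flip: poly_fract_simps(8))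
  then show ?thesis using e IntR_subset by blast
qed

lemma glue_polynomial_ideals:
  assumes N: "\<And>T. T \<in> \<Theta> \<Longrightarrow> normal_pair T d (N T) (N' T)" and d: "d \<in> D"
  shows "\<exists>M. invertible_frac_ideal (IntR D) M \<and> (\<forall>T\<in>\<Theta>. M \<star> IntR T = N T)"
proof -
  have d0: "d \<noteq> 0" using nonempty N by (auto simp: normal_pair_def)
  have *: "N T \<star> IntR T = N T" "N' T \<star> IntR T = N' T" "N T \<star> N' T = IntR T"
    "const_fract d \<in> N T" "const_fract d \<in> N' T" if "T \<in> \<Theta>" for T
    using N[OF that] by (auto simp: normal_pair_def)
  note subT = domain_with_qfD(1)[OF domain_T]
  have rings: "\<forall>T\<in>\<Theta>. subring_of (IntR T) \<and> const_fract ` T \<subseteq> IntR T"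
    by (simp add: subring_IntR subT const_fract_image_subset)
  have modules: "\<forall>T\<in>\<Theta>. N T \<star> IntR T = N T \<and> N' T \<star> IntR T = N' T \<and> N T \<star> N' T = IntR T"
    by (simp add: *)
  have bound: "\<forall>T\<in>\<Theta>. const_fract d \<in> N T \<and> const_fract d \<in> N' T" by (simp add: *)
  have denominators: "\<forall>T\<in>\<Theta>. \<forall>x\<in>IntR T. \<exists>e\<in>D. e \<noteq> 0 \<and> (\<forall>T'\<in>\<Theta>. const_fract e * x \<in> IntR T')"
    using IntR_common_denominator by blast
  note glue = const.glue_inverse[OF rings modules d d0 bound denominators IntR_Inter_eq refl refl]
  have "invertible_frac_ideal (IntR D) (\<Inter>T\<in>\<Theta>. N T)"
    by (rule invertibleI[OF domain_IntR[OF D] glue(1,2,3)])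
  moreover have "(\<Inter>T\<in>\<Theta>. N T) \<star> IntR T = N T" if "T \<in> \<Theta>" for T
    using glue(4)[OF that] IntR_module_extension[OF that glue(1)] by simp
  ultimately show ?thesis by blast
qed

lemma glue_ideals:
  assumes I: "\<And>T. T \<in> \<Theta> \<Longrightarrow> I T \<star> T = I T" "\<And>T. T \<in> \<Theta> \<Longrightarrow> I' T \<star> T = I' T" "\<And>T. T \<in> \<Theta> \<Longrightarrow> I T \<star> I' T = T"
    and d: "d \<in> D" "d \<noteq> 0" "\<And>T. T \<in> \<Theta> \<Longrightarrow> d \<in> I T" "\<And>T. T \<in> \<Theta> \<Longrightarrow> d \<in> I' T"
  shows "\<exists>J. invertible_frac_ideal D J \<and> (\<forall>T\<in>\<Theta>. J \<star> T = I T)"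
proof -
  have den: "\<exists>e\<in>D. e \<noteq> 0 \<and> (\<forall>T'\<in>\<Theta>. e * x \<in> T')" for x
  proof -
    obtain a b where "a \<in> D" "b \<in> D" "b \<noteq> 0" "x = a / b" using domain_with_qfD(2)[OF D] by blast
    then show ?thesis using D_sub_T by (intro bexI[of _ b]) auto
  qed
  note subT = domain_with_qfD(1)[OF domain_T]
  have rings: "\<forall>T\<in>\<Theta>. subring_of T \<and> (\<lambda>x. x) ` T \<subseteq> T" by (simp add: subT)
  have modules: "\<forall>T\<in>\<Theta>. I T \<star> T = I T \<and> I' T \<star> T = I' T \<and> I T \<star> I' T = T" by (simp add: I)
  have bound: "\<forall>T\<in>\<Theta>. d \<in> I T \<and> d \<in> I' T" by (simp add: d)
  have denominators: "\<forall>T\<in>\<Theta>. \<forall>x\<in>T. \<exists>e\<in>D. e \<noteq> 0 \<and> (\<forall>T'\<in>\<Theta>. e * x \<in> T')" using den by blast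
  note glue = id.glue_inverse[OF rings modules d(1,2) bound denominators Inter_eq refl refl]
  have "invertible_frac_ideal D (\<Inter>T\<in>\<Theta>. I T)" by (rule invertibleI[OF D glue(1,2,3)])
  moreover have "(\<Inter>T\<in>\<Theta>. I T) \<star> T = I T" if "T \<in> \<Theta>" for T using glue(4)[OF that] by simp
  ultimately show ?thesis by blast
qed

text \<open>Two refinements prepare for gluing: the constant lies in \<open>D\<close>, so that it
  makes sense at every member, and it is \<open>1\<close> for the trivial class, so that only
  finitely many of the constants differ from \<open>1\<close>.\<close>

lemma exists_normal_pair_D:
  assumes T: "T \<in> \<Theta>" and s: "s \<in> carrier (PicInt T)"
  shows "\<exists>N N' d. d \<in> D \<and> normal_pair T d N N' \<and> picint_class T N = s \<and> (s = \<one>\<^bsub>PicInt T\<^esub> \<longrightarrow> d = 1)"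
proof (cases "s = \<one>\<^bsub>PicInt T\<^esub>")
  case True
  note R = subring_IntR[OF domain_with_qfD(1)[OF domain_T[OF T]]]
  have "normal_pair T 1 (IntR T) (IntR T)"
    using subring_ofD(2)[OF R] subring_ofD(2)[OF domain_with_qfD(1)[OF domain_T[OF T]]]
    by (simp add: normal_pair_def prod_span_subring[OF R] const.hom_one)
  then show ?thesis using True picint_class_one[OF domain_T[OF T]] subring_ofD(2)[OF subring_D] by blast
next
  case False
  note A = domain_T[OF T]
  obtain M where M: "invertible_frac_ideal (IntR T) M" "s = picint_class T M"
    using s by (auto simp: carrier_PicInt)
  obtain x N' d where x: "x \<noteq> 0" "normal_pair T d ({x} \<star> M) N'"
    using exists_normal_pair[OF A M(1)] by blast
  obtain a b where ab: "a \<in> D" "b \<in> D" "b \<noteq> 0" "d = a / b" using domain_with_qfD(2)[OF D] by blast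
  \<comment> \<open>The constant \<open>d\<close> of the pair is only known to lie in
    \<open>T\<close>. Its numerator \<open>a = d * b\<close> lies in \<open>D\<close> and, as a
    multiple of \<open>d\<close>, still in both ideals.\<close>
  have a: "a = d * b" using ab by simp
  have "const_fract a \<in> J" if "J \<star> IntR T = J" "const_fract d \<in> J" for J
    unfolding a const.hom_mult using ab(2) D_sub_T[OF T]
    by (intro module_scale[OF that] const_fract_mem_IntR domain_with_qfD(1)[OF A]) auto
  moreover have "a \<noteq> 0" using a ab(3) x(2) by (simp add: normal_pair_def)
  ultimately have "normal_pair T a ({x} \<star> M) N'"
    using x(2) ab(1) D_sub_T[OF T] unfolding normal_pair_def by blast
  moreover have "picint_class T ({x} \<star> M) = s"
    using picint_class_scale[OF A M(1) x(1)] M(2) by simp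
  ultimately show ?thesis using ab(1) False by blast
qed

text \<open>The constants at the finitely many nontrivial coordinates are multiplied to a single
  \<open>d\<close>. It is a multiple in \<open>D\<close> of each local constant, the remaining ones
  being \<open>1\<close>, so it bounds all the chosen ideals and their inverses.\<close>

lemma localization_surj:
  assumes s: "s \<in> carrier (sum_group \<Theta> PicInt)"
  shows "\<exists>M. invertible_frac_ideal (IntR D) M \<and> localization M = s"
proof -
  have s': "s \<in> (\<Pi>\<^sub>E T\<in>\<Theta>. carrier (PicInt T))" and fin: "finite {T \<in> \<Theta>. s T \<noteq> \<one>\<^bsub>PicInt T\<^esub>}"
    using s unfolding carrier_sum by blast+
  have "\<forall>T\<in>\<Theta>. \<exists>N N' d. d \<in> D \<and> normal_pair T d N N' \<and> picint_class T N = s T \<and> (s T = \<one>\<^bsub>PicInt T\<^esub> \<longrightarrow> d = 1)"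
    using exists_normal_pair_D PiE_mem[OF s'] by blast
  then obtain N N' c where N: "\<And>T. T \<in> \<Theta> \<Longrightarrow> c T \<in> D" "\<And>T. T \<in> \<Theta> \<Longrightarrow> normal_pair T (c T) (N T) (N' T)"
    "\<And>T. T \<in> \<Theta> \<Longrightarrow> picint_class T (N T) = s T" "\<And>T. T \<in> \<Theta> \<Longrightarrow> s T = \<one>\<^bsub>PicInt T\<^esub> \<Longrightarrow> c T = 1"
    by metis
  define S where "S = {T \<in> \<Theta>. s T \<noteq> \<one>\<^bsub>PicInt T\<^esub>}"
  define d where "d = (\<Prod>T\<in>S. c T)"
  have prod_D: "(\<Prod>T\<in>S'. c T) \<in> D" if "S' \<subseteq> \<Theta>" for S'
    using that N(1) subring_ofD(2,4)[OF subring_D]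
    by (induction S' rule: infinite_finite_induct) auto
  have d0: "d \<noteq> 0"
    using fin N(2) by (auto simp: d_def S_def prod_zero_iff normal_pair_def)
  have "normal_pair T d (N T) (N' T)" if T: "T \<in> \<Theta>" for T
  proof -
    have "\<exists>r\<in>D. d = c T * r"
    proof (cases "T \<in> S")
      case True
      then have "d = c T * (\<Prod>T\<in>S - {T}. c T)" using fin unfolding d_def S_def by (intro prod.remove) auto
      moreover have "(\<Prod>T\<in>S - {T}. c T) \<in> D" by (rule prod_D) (auto simp: S_def)
      ultimately show ?thesis by blast
    next
      case False
      then have "c T = 1" using N(4) T by (auto simp: S_def)
      then show ?thesis using prod_D[of S] by (auto simp: d_def S_def)
    qed
    then obtain r where r: "r \<in> D" "d = c T * r" by blast
    have "const_fract d \<in> J" if "J \<star> IntR T = J" "const_fract (c T) \<in> J" for J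
      unfolding r(2) const.hom_mult using r(1) D_sub_T[OF T]
      by (intro module_scale[OF that] const_fract_mem_IntR domain_with_qfD(1)[OF domain_T[OF T]]) auto
    moreover have "d \<in> T" using prod_D[of S] D_sub_T[OF T] by (auto simp: d_def S_def)
    ultimately show ?thesis using N(2)[OF T] d0 by (auto simp: normal_pair_def)
  qed
  then obtain M where M: "invertible_frac_ideal (IntR D) M" "\<And>T. T \<in> \<Theta> \<Longrightarrow> M \<star> IntR T = N T"
    using glue_polynomial_ideals[of d N N'] prod_D[of S] by (auto simp: d_def S_def)
  have "localization M T = s T" for T
    using M(2) N(3) PiE_arb[OF s'] by (cases "T \<in> \<Theta>") (auto simp: localization_def)
  then show ?thesis using M(1) by blast
qed

text \<open>Triviality over the polynomial ring forces the local generator to be a constant, so it can be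
  absorbed into the ideal of constants; the local ideals of constants then glue.\<close>

lemma localization_eq_one_imp:
  assumes M: "invertible_frac_ideal (IntR D) M" and one: "localization M = \<one>\<^bsub>sum_group \<Theta> PicInt\<^esub>"
  shows "pic_class (IntR D) M \<in> iota D ` carrier (Pic D)"
proof -
  note R = domain_IntR[OF D]
  obtain x J' d where x: "x \<noteq> 0" "normal_pair D d ({x} \<star> M) J'"
    using exists_normal_pair[OF D M] by blast
  define J where "J = {x} \<star> M"
  note np = x(2)[folded J_def]
  have J: "J \<star> IntR D = J" "J' \<star> IntR D = J'" "J \<star> J' = IntR D" and d: "d \<in> D" "d \<noteq> 0"
    using np by (auto simp: normal_pair_def)
  \<comment> \<open>Besides the local equation, \<open>P\<close> records that the same
    \<open>d\<close> lies in \<open>I\<close> and in its inverse; \<open>glue_ideals\<close> relies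
    on this uniform bound.\<close>
  define P where "P T I I' \<longleftrightarrow> I \<star> T = I \<and> I' \<star> T = I' \<and> I \<star> I' = T \<and> d \<in> I \<and> d \<in> I' \<and>
      J \<star> IntR T = const_fract ` I \<star> IntR T" for T I I'
  have "\<exists>I I'. P T I I'" if T: "T \<in> \<Theta>" for T
  proof -
    note A = domain_T[OF T] and subA = domain_with_qfD(1)[OF domain_T[OF T]]
    have npT: "normal_pair T d (J \<star> IntR T) (J' \<star> IntR T)" by (rule normal_pair_extension[OF T np])
    have inv: "invertible_frac_ideal (IntR T) (M \<star> IntR T)" by (rule invertible_extension_T[OF T M])
    have "localization M T = \<one>\<^bsub>PicInt T\<^esub>" using one T by simp
    then have "picint_class T (M \<star> IntR T) = \<one>\<^bsub>PicInt T\<^esub>" using T by (simp add: localization_def)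
    then obtain I0 y where I0: "invertible_frac_ideal T I0" "y \<noteq> 0"
      "M \<star> IntR T = {y} \<star> (const_fract ` I0 \<star> IntR T)"
      unfolding picint_class_eq_one_iff[OF A inv] by blast
    have JT: "J \<star> IntR T = {x * y} \<star> (const_fract ` I0 \<star> IntR T)"
      by (simp add: J_def prod_span_assoc I0(3) prod_span_singletons)
    note KX = prod_span_IntR_KX[OF subA]
    obtain c where c: "c \<in> I0" "c \<noteq> 0" using invertible_nonzero[OF A I0(1)] by blast
    have "{x * y} \<star> IntR UNIV = J \<star> IntR T \<star> IntR UNIV"
      unfolding JT by (simp add: prod_span_assoc KX const_extension_KX[OF c])
    also have "\<dots> = IntR UNIV"
    proof
      have "const_fract d \<in> J \<star> IntR T" "const_fract d \<in> J' \<star> IntR T"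
        using npT by (auto simp: normal_pair_def)
      then have sub: "const_fract ` {d} \<subseteq> J \<star> IntR T" "const_fract ` {d} \<subseteq> J' \<star> IntR T" by auto
      have dKX: "const_fract ` {d} \<star> IntR UNIV = IntR UNIV" by (rule const_extension_KX[OF _ d(2)]) simp
      then show "IntR UNIV \<subseteq> J \<star> IntR T \<star> IntR UNIV"
        using prod_span_mono[OF sub(1) order_refl, of "IntR UNIV"] by simp
      \<comment> \<open>The upper bound uses the inverse: \<open>d\<close> is a unit of
        \<open>K[X]\<close> lying in the extension of \<open>J'\<close>, so inserting it enlarges
        the product to \<open>J J' K[X] = K[X]\<close>.\<close>
      have "J \<star> IntR T \<star> IntR UNIV = J \<star> IntR T \<star> (const_fract ` {d} \<star> IntR UNIV)" by (simp only: dKX)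
      also have "\<dots> \<subseteq> J \<star> IntR T \<star> (J' \<star> IntR T \<star> IntR UNIV)"
        by (intro prod_span_mono sub order_refl)
      also have "\<dots> = (J \<star> IntR T \<star> (J' \<star> IntR T)) \<star> IntR UNIV" by (simp only: prod_span_assoc)
      also have "\<dots> = IntR UNIV" using npT KX by (simp add: normal_pair_def)
      finally show "J \<star> IntR T \<star> IntR UNIV \<subseteq> IntR UNIV" .
    qed
    finally obtain u where u: "u \<noteq> 0" "x * y = const_fract u" using scale_KX_constant[of "x * y"] by blast
    define I where "I = {u} \<star> I0"
    have I: "invertible_frac_ideal T I" unfolding I_def by (rule invertible_scale[OF A I0(1) u(1)])
    then obtain I' where I': "I \<star> T = I" "I' \<star> T = I'" "I \<star> I' = T" by (rule invertibleE[OF A])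
    have eq: "J \<star> IntR T = const_fract ` I \<star> IntR T"
      by (simp add: JT u(2) I_def const.image_scale prod_span_assoc)
    note TS = prod_span_const_fract_IntR[OF subA]
    \<comment> \<open>Inverses are unique, so the extension of \<open>J'\<close> is generated by the
      inverse ideal \<open>I'\<close> of constants. Contraction then places \<open>d\<close> in
      \<open>I'\<close> as well as in \<open>I\<close>.\<close>
    have "J' \<star> IntR T = J' \<star> IntR T \<star> (const_fract ` (I \<star> I') \<star> IntR T)"
      using npT by (simp add: I' TS normal_pair_def)
    also have "\<dots> = J' \<star> IntR T \<star> (const_fract ` I \<star> IntR T) \<star> const_fract ` I'"
      by (simp only: const.image_prod_span prod_span_ac)
    also have "J' \<star> IntR T \<star> (const_fract ` I \<star> IntR T) = IntR T"
      unfolding eq[symmetric] using npT by (simp add: normal_pair_def prod_span_commute)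
    finally have eq': "J' \<star> IntR T = const_fract ` I' \<star> IntR T" by (simp only: prod_span_commute)
    have "d \<in> I" "d \<in> I'"
      using npT contraction_extension[OF subA I'(1), of d] contraction_extension[OF subA I'(2), of d]
      by (auto simp: normal_pair_def eq eq')
    then show ?thesis using I' eq unfolding P_def by blast
  qed
  then obtain I I' where "\<And>T. T \<in> \<Theta> \<Longrightarrow> P T (I T) (I' T)" by metis
  then have I: "\<And>T. T \<in> \<Theta> \<Longrightarrow> I T \<star> T = I T" "\<And>T. T \<in> \<Theta> \<Longrightarrow> I' T \<star> T = I' T"
    "\<And>T. T \<in> \<Theta> \<Longrightarrow> I T \<star> I' T = T" "\<And>T. T \<in> \<Theta> \<Longrightarrow> d \<in> I T" "\<And>T. T \<in> \<Theta> \<Longrightarrow> d \<in> I' T"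
    and JT: "\<And>T. T \<in> \<Theta> \<Longrightarrow> J \<star> IntR T = const_fract ` I T \<star> IntR T"
    by (simp_all add: P_def)
  obtain L where L: "invertible_frac_ideal D L" "\<And>T. T \<in> \<Theta> \<Longrightarrow> L \<star> T = I T"
    using glue_ideals[of I I' d] I d by blast
  define L' where "L' = const_fract ` L \<star> IntR D"
  have L': "L' \<star> IntR D = L'"
    by (simp add: L'_def prod_span_assoc prod_span_subring domain_with_qfD(1)[OF R])
  have local_eq: "L' \<star> const_fract ` T = J \<star> const_fract ` T" if T: "T \<in> \<Theta>" for T
  proof -
    note subA = domain_with_qfD(1)[OF domain_T[OF T]]
    note TS = prod_span_const_fract_IntR[OF subA]
    have "L' \<star> IntR T = const_fract ` L \<star> (const_fract ` T \<star> IntR T)"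
      by (simp add: L'_def prod_span_assoc prod_span_IntR[OF T] TS)
    also have "\<dots> = const_fract ` (L \<star> T) \<star> IntR T"
      by (simp add: const.image_prod_span prod_span_assoc)
    also have "\<dots> = J \<star> IntR T" by (simp add: L(2)[OF T] JT[OF T])
    finally show ?thesis using IntR_module_extension[OF T] L' J(1) by simp
  qed
  \<comment> \<open>Modules over \<open>Int(D)\<close> are determined by their extensions to the
    members of \<open>\<Theta>\<close>; used in both directions, this identifies \<open>J\<close>
    with \<open>L'\<close>.\<close>
  have "N \<subseteq> N'" if N: "N \<star> IntR D = N" "N' \<star> IntR D = N'"
    and eq: "\<And>T. T \<in> \<Theta> \<Longrightarrow> N \<star> const_fract ` T = N' \<star> const_fract ` T" for N N'
  proof
    fix z assume z: "z \<in> N"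
    show "z \<in> N'"
    proof (rule const.local_global)
      have "IntR D \<star> const_fract ` D = IntR D"
        by (intro prod_span_overring domain_with_qfD(1)[OF R] const.subring_of_image subring_D
            const_fract_image_subset)
      then show "N' \<star> const_fract ` D = N'" using N(2) by (metis prod_span_assoc)
      fix T assume T: "T \<in> \<Theta>"
      have "1 \<in> T" by (rule subring_ofD(2)[OF domain_with_qfD(1)[OF domain_T[OF T]]])
      then have "1 \<in> const_fract ` T" using const.hom_one by (intro rev_image_eqI[of 1]) auto
      then have "N \<subseteq> N \<star> const_fract ` T" by (rule subset_prod_span_one)
      then show "z \<in> N' \<star> const_fract ` T" using z eq[OF T] by blast
    qed
  qed
  from this[OF L' J(1) local_eq] this[OF J(1) L' local_eq[symmetric]] have "J = L'" by (rule subset_antisym[rotated])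
  then have "M = {inverse x} \<star> (const_fract ` L \<star> IntR D)"
    using prod_span_singleton_cancel(2)[OF x(1) invertible_module(3)[OF R M]] by (simp add: J_def L'_def)
  then show ?thesis
    unfolding pic_class_mem_iota_image_iff[OF D M] using L(1) x(1) nonzero_imp_inverse_nonzero by blast
qed

text \<open>Over \<open>Int(T)\<close> the extension of \<open>I\<close> coincides with that of the
  ideal \<open>I \<star> T\<close> of constants in \<open>T\<close>, which is trivial in
  \<open>PicInt T\<close>. This gives the inclusion of the image of \<open>iota\<close> in the
  kernel.\<close>

lemma localization_iota:
  assumes I: "invertible_frac_ideal D I" and "x \<noteq> 0"
  shows "localization ({x} \<star> (const_fract ` I \<star> IntR D)) = \<one>\<^bsub>sum_group \<Theta> PicInt\<^esub>"
proof -
  have "picint_class T ({x} \<star> (const_fract ` I \<star> IntR D) \<star> IntR T) = \<one>\<^bsub>PicInt T\<^esub>" if T: "T \<in> \<Theta>" for T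
  proof -
    note A = domain_T[OF T] and subA = domain_with_qfD(1)[OF domain_T[OF T]]
    note TS = prod_span_const_fract_IntR[OF subA]
    have "const_fract ` I \<star> IntR D \<star> IntR T = const_fract ` I \<star> (const_fract ` T \<star> IntR T)"
      by (simp add: prod_span_assoc prod_span_IntR[OF T] TS)
    also have "\<dots> = const_fract ` (I \<star> T) \<star> IntR T" by (simp add: const.image_prod_span prod_span_assoc)
    finally have eq: "{x} \<star> (const_fract ` I \<star> IntR D) \<star> IntR T = {x} \<star> (const_fract ` (I \<star> T) \<star> IntR T)"
      by (simp only: prod_span_assoc)
    have IT: "invertible_frac_ideal T (I \<star> T)"
      using unital_hom.invertible_extension[OF unital_hom_id D A _ I] D_sub_T[OF T] by simp
    have "invertible_frac_ideal (IntR T) ({x} \<star> (const_fract ` (I \<star> T) \<star> IntR T))"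
      by (intro invertible_scale domain_IntR A assms(2)
          const.invertible_extension[OF A domain_IntR[OF A] const_fract_image_subset[OF subA] IT])
    then show ?thesis unfolding eq using IT assms(2) by (subst picint_class_eq_one_iff[OF A]) blast+
  qed
  then show ?thesis by (auto simp: localization_def intro!: restrict_ext)
qed

end

theorem theorem4p7:
  fixes D :: "'k::field set" and \<Theta> :: "'k set set"
  assumes "domain_with_qf D"
    and "jaffard D \<Theta>"
  shows "iota D \<in> hom (Pic D) (Pic (IntR D))
       \<and> inj_on (iota D) (carrier (Pic D))
       \<and> (\<exists>\<phi>. \<phi> \<in> hom (Pic (IntR D)) (sum_group \<Theta> PicInt)
              \<and> \<phi> ` carrier (Pic (IntR D)) = carrier (sum_group \<Theta> PicInt)
              \<and> kernel (Pic (IntR D)) (sum_group \<Theta> PicInt) \<phi> = iota D ` carrier (Pic D))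
       \<and> PicInt D \<cong> sum_group \<Theta> PicInt"
proof -
  interpret jaffard_family D \<Theta> using assms by unfold_locales
  note R = domain_IntR[OF D]
  have sum: "group (sum_group \<Theta> PicInt)" by (rule sum_group[OF group_PicInt])
  interpret loc: group_hom "InvIdeals (IntR D)" "sum_group \<Theta> PicInt" localization
    using localization_hom comm_group_InvIdeals[OF R] sum
    by (simp add: group_hom_def group_hom_axioms_def comm_group_def)
  have iota_kernel: "localization M = \<one>\<^bsub>sum_group \<Theta> PicInt\<^esub> \<longleftrightarrow> pic_class (IntR D) M \<in> iota D ` carrier (Pic D)"
    if M: "invertible_frac_ideal (IntR D) M" for M
    using localization_eq_one_imp[OF M] localization_iota pic_class_mem_iota_image_iff[OF D M] by metis
  interpret iota: group_hom "Pic D" "Pic (IntR D)" "iota D"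
    using iota_hom[OF D] comm_group_Pic[OF D] comm_group_Pic[OF R]
    by (auto simp: group_hom_def group_hom_axioms_def comm_group_def)
  \<comment> \<open>The class of a principal ideal is the identity, which lies in the image of
    \<open>iota\<close>; the kernel description then lets \<open>localization\<close> factor through
    \<open>Pic\<close>.\<close>
  have "principal_ideals (IntR D) \<subseteq> kernel (InvIdeals (IntR D)) (sum_group \<Theta> PicInt) localization"
  proof
    fix M assume M: "M \<in> principal_ideals (IntR D)"
    then have inv: "invertible_frac_ideal (IntR D) M" by (simp add: principal_ideals_def)
    obtain x where x: "x \<noteq> 0" "M = {x} \<star> IntR D" using M by (auto simp: principal_ideals_eq[OF R])
    then have "pic_class (IntR D) M = \<one>\<^bsub>Pic (IntR D)\<^esub>"
      using pic_class_scale[OF R invertible_unit[OF R] x(1)] pic_class_one[OF R] by simp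
    also have "\<dots> \<in> iota D ` carrier (Pic D)"
      using imageI[OF iota.G.one_closed, of "iota D"] by simp
    finally have "pic_class (IntR D) M \<in> iota D ` carrier (Pic D)" .
    then show "M \<in> kernel (InvIdeals (IntR D)) (sum_group \<Theta> PicInt) localization"
      using iota_kernel[OF inv] inv by (simp add: kernel_def InvIdeals_def)
  qed
  then obtain \<phi> where \<phi>: "\<phi> \<in> hom (Pic (IntR D)) (sum_group \<Theta> PicInt)"
    "\<And>M. M \<in> carrier (InvIdeals (IntR D)) \<Longrightarrow> \<phi> (pic_class (IntR D) M) = localization M"
    using loc.FactGroup_universal_kernel[OF normal_principal_ideals[OF R]]
    unfolding Pic_alt[of "IntR D"] pic_class_def by blast
  then have \<phi>_class: "\<phi> (pic_class (IntR D) M) = localization M" if "invertible_frac_ideal (IntR D) M" for M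
    using that by (simp add: InvIdeals_def)
  have surj: "\<phi> ` carrier (Pic (IntR D)) = carrier (sum_group \<Theta> PicInt)"
  proof
    show "\<phi> ` carrier (Pic (IntR D)) \<subseteq> carrier (sum_group \<Theta> PicInt)"
      using hom_carrier[OF \<phi>(1)] .
    show "carrier (sum_group \<Theta> PicInt) \<subseteq> \<phi> ` carrier (Pic (IntR D))"
    proof
      fix s assume "s \<in> carrier (sum_group \<Theta> PicInt)"
      then obtain M where "invertible_frac_ideal (IntR D) M" "localization M = s"
        using localization_surj by blast
      then show "s \<in> \<phi> ` carrier (Pic (IntR D))"
        using \<phi>_class[of M] by (auto simp: carrier_Pic image_iff)
    qed
  qed
  have image_sub: "iota D ` carrier (Pic D) \<subseteq> carrier (Pic (IntR D))"
    by (rule hom_carrier[OF iota.homh])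
  have ker: "kernel (Pic (IntR D)) (sum_group \<Theta> PicInt) \<phi> = iota D ` carrier (Pic D)"
  proof -
    have "C \<in> kernel (Pic (IntR D)) (sum_group \<Theta> PicInt) \<phi> \<longleftrightarrow> C \<in> iota D ` carrier (Pic D)"
      if "C \<in> carrier (Pic (IntR D))" for C
    proof -
      obtain M where M: "invertible_frac_ideal (IntR D) M" "C = pic_class (IntR D) M"
        using \<open>C \<in> carrier (Pic (IntR D))\<close> by (auto simp: carrier_Pic)
      then show ?thesis
        using that iota_kernel[OF M(1)] \<phi>_class[OF M(1)] by (simp add: kernel_def del: one_sum_group)
    qed
    then show ?thesis using image_sub by (auto simp: kernel_def)
  qed
  interpret \<phi>: group_hom "Pic (IntR D)" "sum_group \<Theta> PicInt" \<phi>
    using \<phi>(1) comm_group_Pic[OF R] sum by (simp add: group_hom_def group_hom_axioms_def comm_group_def)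
  have "PicInt D \<cong> sum_group \<Theta> PicInt"
    using \<phi>.FactGroup_iso[OF surj] by (simp only: ker PicInt_def)
  then show ?thesis using iota_hom[OF D] iota_inj[OF D] \<phi>(1) surj ker by blast
qed

end
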